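(* Let $X$ be a complex HI$_\xi$ Banach space for some $1\le\xi<\omega_1$, let $Y$ be an infinite-dimensional subspace of $X$ and let $T\in\mathcal{L}(Y,X)$. Then there exist $\lambda\in\mathbb{C}$ and $S\in\mathcal{SS}_\xi(Y,X)$ such that $T=\lambda i_{Y,X}+S$, where $i_{Y,X}:Y\to X$ is the inclusion map.
   Context: $\mathbb{N}=\{1,2,\dots\}$; subspaces are closed; $\mathcal{L}(Y,X)$ is the space of bounded linear operators from $Y$ to $X$; $\#$ denotes cardinality; $[x_i]_{i\in F}$ is the closed linear span of $\{x_i\}_{i\in F}$. For finite sets $A,B\subseteq\mathbb{N}$, $A<B$ means $\max A<\min B$, and $n\le A$ means $n\le\min A$ (the empty set satisfies all such relations). Schreier families. For families $\mathcal{F},\mathcal{G}$ of finite subsets of $\mathbb{N}$ put $\mathcal{F}[\mathcal{G}]=\{\bigcup_{i=1}^n G_i : n\in\mathbb{N},\ G_1<\dots<G_n,\ G_i\in\mathcal{G}\text{ for } i\le n,\ \{\min G_i\}_{i=1}^n\in\mathcal{F}\}$. Let $\mathcal{S}_0=\{\{n\}:n\in\mathbb{N}\}\cup\{\varnothing\}$, $\mathcal{S}_1=\{F\subseteq\mathbb{N}\text{ finite}: \#F\le\min F\}$ (including $\varnothing$), $\mathcal{S}_{\xi+1}=\mathcal{S}_1[\mathcal{S}_\xi]$, and for a countable limit ordinal $\xi$ fix a sequence of ordinals $\xi_n\nearrow\xi$ and let $\mathcal{S}_\xi=\{F: n\le F\text{ and }F\in\mathcal{S}_{\xi_n}\text{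 for some }n\in\mathbb{N}\}$. A Banach space $X$ is $\mathcal{S}_\xi$-hereditarily indecomposable (HI$_\xi$) if for every $\varepsilon>0$, every infinite-dimensional subspace $Z\subseteq X$ and every basic sequence $(x_n)$ in $X$ there exist $F\in\mathcal{S}_\xi$ and a unit vector $z\in Z$ with $\mathrm{dist}(z,[x_i]_{i\in F})<\varepsilon$. $S\in\mathcal{L}(Y,X)$ is $\mathcal{S}_\xi$-strictly singular, $S\in\mathcal{SS}_\xi(Y,X)$, if for every $\varepsilon>0$ and every basic sequence $(x_n)$ in $Y$ there exist $F\in\mathcal{S}_\xi$ and $z\in[x_i]_{i\in F}\setminus\{0\}$ with $\|Sz\|\le\varepsilon\|z\|$. *)

theory Defs
  imports "HOL-Analysis.Analysis" "HOL-Library.Countable_Set"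
begin

text \<open>The elements of the initial well-order of cardinality \<open>\<aleph>\<^sub>1\<close>, i.e. the ordinals below \<open>\<omega>\<^sub>1\<close>.
  The lemmas \<open>countable_initial_segment\<close> and \<open>uncountable_UNIV\<close> below pin down the order type.\<close>

typedef countable_ordinal = "Field (cardSuc natLeq)"
  using Field_cardSuc_not_empty[OF natLeq_Card_order] by auto

abbreviation (input) omega1_rel :: "nat set rel" where
  "omega1_rel \<equiv> cardSuc natLeq"

lemma omega1_Well_order: "Well_order omega1_rel"
  by (rule cardSuc_Well_order[OF natLeq_Card_order])

instantiation countable_ordinal :: wellorder
begin

definition less_eq_countable_ordinal :: "countable_ordinal \<Rightarrow> countable_ordinal \<Rightarrow> bool" where
  "x \<le> y \<longleftrightarrow> (Rep_countable_ordinal x, Rep_countable_ordinal y) \<in> cardSuc natLeq"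

definition less_countable_ordinal :: "countable_ordinal \<Rightarrow> countable_ordinal \<Rightarrow> bool" where
  "(x :: countable_ordinal) < y \<longleftrightarrow> x \<le> y \<and> x \<noteq> y"

instance
proof
  note wo = omega1_Well_order[unfolded well_order_on_def linear_order_on_def
      partial_order_on_def preorder_on_def]
  have refl: "x \<le> x" for x :: countable_ordinal
    using wo Rep_countable_ordinal[of x]
    by (auto simp: less_eq_countable_ordinal_def refl_on_def)
  have antisym: "x \<le> y \<Longrightarrow> y \<le> x \<Longrightarrow> x = y" for x y :: countable_ordinal
    using wo unfolding less_eq_countable_ordinal_def antisym_def
    by (metis Rep_countable_ordinal_inject)
  have trans: "x \<le> y \<Longrightarrow> y \<le> z \<Longrightarrow> x \<le> z" for x y z :: countable_ordinal
    using wo unfolding less_eq_countable_ordinal_def trans_def by blast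
  have total: "x \<le> y \<or> y \<le> x" for x y :: countable_ordinal
    using wo Rep_countable_ordinal[of x] Rep_countable_ordinal[of y] refl[of x]
    unfolding less_eq_countable_ordinal_def total_on_def
    by (metis Rep_countable_ordinal_inject)
  fix x y z :: countable_ordinal
  show "x < y \<longleftrightarrow> x \<le> y \<and> \<not> y \<le> x"
    using antisym[of x y] refl by (auto simp: less_countable_ordinal_def)
  show "x \<le> x" by (rule refl)
  show "x \<le> y \<Longrightarrow> y \<le> z \<Longrightarrow> x \<le> z" by (rule trans)
  show "x \<le> y \<Longrightarrow> y \<le> x \<Longrightarrow> x = y" by (rule antisym)
  show "x \<le> y \<or> y \<le> x" by (rule total)
next
  fix P :: "countable_ordinal \<Rightarrow> bool" and a
  assume step: "\<And>x. (\<And>y. y < x \<Longrightarrow> P y) \<Longrightarrow> P x"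
  have "wf (inv_image (omega1_rel - Id) Rep_countable_ordinal)"
    using omega1_Well_order by (intro wf_inv_image) (simp add: well_order_on_def)
  moreover have "inv_image (omega1_rel - Id) Rep_countable_ordinal = {(x, y). x < y}"
    by (auto simp: inv_image_def less_countable_ordinal_def less_eq_countable_ordinal_def
        Rep_countable_ordinal_inject)
  ultimately have "wf {(x, y :: countable_ordinal). x < y}" by simp
  then show "P a" by (induction a rule: wf_induct_rule) (use step in auto)
qed

end

context
  includes cardinal_syntax
begin

lemma countable_iff_ordLeq_natLeq: "countable A \<longleftrightarrow> |A| \<le>o natLeq"
proof -
  have "countable A \<longleftrightarrow> |A| \<le>o |UNIV :: nat set|"
    unfolding countable_def card_of_ordLeq[symmetric] by auto
  also have "\<dots> \<longleftrightarrow> |A| \<le>o natLeq"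
    using card_of_nat ordIso_symmetric ordLeq_ordIso_trans by blast
  finally show ?thesis .
qed

lemma countable_initial_segment: "countable {..< (\<xi> :: countable_ordinal)}"
proof -
  let ?a = "Rep_countable_ordinal \<xi>"
  have "|underS omega1_rel ?a| <o omega1_rel"
    by (rule card_of_underS[OF cardSuc_Card_order[OF natLeq_Card_order] Rep_countable_ordinal])
  then have "|underS omega1_rel ?a| \<le>o natLeq"
    using cardSuc_ordLeq_ordLess[OF natLeq_Card_order card_of_Card_order] by blast
  then have "countable (underS omega1_rel ?a)"
    by (simp add: countable_iff_ordLeq_natLeq)
  moreover have "Rep_countable_ordinal ` {..<\<xi>} \<subseteq> underS omega1_rel ?a"
    by (auto simp: underS_def less_countable_ordinal_def less_eq_countable_ordinal_def
        Rep_countable_ordinal_inject)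
  ultimately show ?thesis
    by (meson countable_image_inj_eq countable_subset inj_on_def Rep_countable_ordinal_inject)
qed

lemma uncountable_UNIV: "uncountable (UNIV :: countable_ordinal set)"
proof
  assume "countable (UNIV :: countable_ordinal set)"
  then have "countable (Rep_countable_ordinal ` UNIV)" by blast
  then have "countable (Field omega1_rel)"
    by (simp add: type_definition.Rep_range[OF type_definition_countable_ordinal])
  then have "|Field omega1_rel| \<le>o natLeq"
    by (simp add: countable_iff_ordLeq_natLeq)
  then have "omega1_rel \<le>o natLeq"
    using card_of_Field_ordIso[OF cardSuc_Card_order[OF natLeq_Card_order]]
      ordIso_symmetric ordIso_ordLeq_trans by blast
  then show False
    using cardSuc_greater[OF natLeq_Card_order] not_ordLess_ordLeq by blast
qed

end

definition ord_succ :: "countable_ordinal \<Rightarrow> countable_ordinal" where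
  "ord_succ \<xi> = (LEAST \<eta>. \<xi> < \<eta>)"

instantiation countable_ordinal :: "{zero, one}"
begin

definition zero_countable_ordinal :: countable_ordinal where
  "0 = (LEAST \<xi> :: countable_ordinal. True)"

definition one_countable_ordinal :: countable_ordinal where
  "1 = ord_succ 0"

instance ..

end

lemma ord_zero_le [simp]: "0 \<le> (\<xi> :: countable_ordinal)"
  unfolding zero_countable_ordinal_def by (rule Least_le) simp

lemma ord_succ_greater [simp]: "\<xi> < ord_succ \<xi>"
proof -
  have "\<exists>\<eta>. \<xi> < \<eta>"
  proof (rule ccontr)
    assume "\<not> ?thesis"
    then have "UNIV = insert \<xi> {..<\<xi>}"
      by (auto simp: not_less order.order_iff_strict)
    then show False
      using uncountable_UNIV countable_initial_segment[of \<xi>] by (metis countable_insert)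
  qed
  then show ?thesis
    unfolding ord_succ_def by (rule LeastI_ex)
qed

lemma ord_succ_le_iff: "ord_succ \<xi> \<le> \<eta> \<longleftrightarrow> \<xi> < \<eta>"
  using ord_succ_greater[of \<xi>] by (auto simp: ord_succ_def intro: Least_le)

lemma ord_succ_inject [simp]: "ord_succ \<xi> = ord_succ \<eta> \<longleftrightarrow> \<xi> = \<eta>"
  by (metis less_irrefl linorder_neqE ord_succ_greater ord_succ_le_iff order.strict_trans1)

lemma ord_succ_nonzero [simp]: "ord_succ \<xi> \<noteq> 0"
  by (metis leD ord_succ_greater ord_zero_le)

definition is_limit :: "countable_ordinal \<Rightarrow> bool" where
  "is_limit \<xi> \<longleftrightarrow> \<xi> \<noteq> 0 \<and> (\<nexists>\<eta>. \<xi> = ord_succ \<eta>)"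

text \<open>\<open>fs \<xi>\<close> is the sequence \<open>(\<xi>\<^sub>n)\<^sub>n\<^sub>\<ge>\<^sub>1\<close> of ordinals below \<open>\<xi>\<close> increasing to \<open>\<xi>\<close>. Increasing is
  understood in the wide sense, so strictly increasing sequences are covered; the values at
  \<open>n = 0\<close> and at non-limit \<open>\<xi>\<close> are irrelevant.\<close>

definition fundamental_sequences :: "(countable_ordinal \<Rightarrow> nat \<Rightarrow> countable_ordinal) \<Rightarrow> bool" where
  "fundamental_sequences fs \<longleftrightarrow>
     (\<forall>\<xi>. is_limit \<xi> \<longrightarrow>
        (\<forall>n\<ge>1. fs \<xi> n < \<xi>) \<and> mono_on {1..} (fs \<xi>) \<and> (\<forall>\<eta><\<xi>. \<exists>n\<ge>1. \<eta> < fs \<xi> n))"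

lemma fundamental_sequences_exist: "\<exists>fs. fundamental_sequences fs"
proof -
  have "\<exists>s :: nat \<Rightarrow> countable_ordinal. (\<forall>n\<ge>1. s n < \<xi>) \<and> mono_on {1..} s \<and> (\<forall>\<eta><\<xi>. \<exists>n\<ge>1. \<eta> < s n)"
    if lim: "is_limit \<xi>" for \<xi>
  proof -
    have ne: "{..<\<xi>} \<noteq> {}"
      using lim ord_zero_le[of \<xi>] unfolding is_limit_def order.order_iff_strict by blast
    define e where "e = from_nat_into {..<\<xi>}"
    have e: "range e = {..<\<xi>}"
      unfolding e_def by (rule range_from_nat_into[OF ne countable_initial_segment])
    define s where "s n = Max (e ` {..n})" for n :: nat
    have "s n < \<xi>" for n
      using e unfolding s_def by auto
    moreover have "s m \<le> s n" if "m \<le> n" for m n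
      unfolding s_def using that by (intro Max_mono) auto
    moreover have "\<exists>n\<ge>1. \<eta> < s n" if "\<eta> < \<xi>" for \<eta>
    proof -
      have "ord_succ \<eta> < \<xi>"
        using that lim ord_succ_le_iff[of \<eta> \<xi>] by (force simp: is_limit_def order.order_iff_strict)
      then obtain k where k: "e k = ord_succ \<eta>" using e by (metis lessThan_iff rangeE)
      have "e k \<le> s (Suc k)" unfolding s_def by (intro Max_ge) auto
      then show ?thesis
        using k by (intro exI[of _ "Suc k"]) (auto simp: ord_succ_le_iff)
    qed
    ultimately show ?thesis by (intro exI[of _ s]) (auto simp: mono_on_def)
  qed
  then show ?thesis unfolding fundamental_sequences_def by metis
qed

text \<open>\<open>A < B\<close> for finite sets: \<open>max A < min B\<close>, with the empty set satisfying all such relations.\<close>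

definition set_before :: "nat set \<Rightarrow> nat set \<Rightarrow> bool" where
  "set_before A B \<longleftrightarrow> (\<forall>a\<in>A. \<forall>b\<in>B. a < b)"

text \<open>The family \<open>F[G]\<close>. Empty blocks are allowed and contribute no minimum; as they satisfy every
  relation \<open><\<close>, the chain \<open>G\<^sub>1 < \<dots> < G\<^sub>n\<close> has to be read pairwise.\<close>

definition family_comp :: "nat set set \<Rightarrow> nat set set \<Rightarrow> nat set set" where
  "family_comp \<F> \<G> =
     {\<Union>i\<in>{1..n}. G i | n (G :: nat \<Rightarrow> nat set).
        1 \<le> n \<and> (\<forall>i\<in>{1..n}. G i \<in> \<G>) \<and>
        (\<forall>i\<in>{1..n}. \<forall>j\<in>{1..n}. i < j \<longrightarrow> set_before (G i) (G j)) \<and>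
        {Min (G i) | i. i \<in> {1..n} \<and> G i \<noteq> {}} \<in> \<F>}"

definition schreier0 :: "nat set set" where
  "schreier0 = {{n} | n. 1 \<le> n} \<union> {{}}"

definition schreier1 :: "nat set set" where
  "schreier1 = {F. finite F \<and> F \<subseteq> {1..} \<and> (F \<noteq> {} \<longrightarrow> card F \<le> Min F)}"

text \<open>The guard \<open>fs \<xi> n < \<xi>\<close> only serves termination; see \<open>schreier_limit\<close>.\<close>

function schreier ::
  "(countable_ordinal \<Rightarrow> nat \<Rightarrow> countable_ordinal) \<Rightarrow> countable_ordinal \<Rightarrow> nat set set" where
  "schreier fs \<xi> =
     (if \<xi> = 0 then schreier0
      else if \<xi> = 1 then schreier1
      else if \<exists>\<eta>. \<xi> = ord_succ \<eta> then family_comp schreier1 (schreier fs (THE \<eta>. \<xi> = ord_succ \<eta>))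
      else {F. \<exists>n\<ge>1. (\<forall>a\<in>F. n \<le> a) \<and> (if fs \<xi> n < \<xi> then F \<in> schreier fs (fs \<xi> n) else False)})"
  by auto
termination
proof (relation "inv_image {(x, y). x < y} snd")
  show "wf (inv_image {(x, y :: countable_ordinal). x < y} snd)"
    by (intro wf_inv_image wf)
qed auto

declare schreier.simps [simp del]

lemma schreier_0: "schreier fs 0 = schreier0"
  by (simp add: schreier.simps)

lemma schreier_1: "schreier fs 1 = schreier1"
  by (subst schreier.simps) (simp add: one_countable_ordinal_def)

lemma schreier_succ:
  "1 \<le> \<xi> \<Longrightarrow> schreier fs (ord_succ \<xi>) = family_comp schreier1 (schreier fs \<xi>)"
  by (subst schreier.simps) (auto simp: one_countable_ordinal_def ord_succ_le_iff)

lemma schreier_limit: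
  assumes "fundamental_sequences fs" "is_limit \<xi>"
  shows "schreier fs \<xi> = {F. \<exists>n\<ge>1. (\<forall>a\<in>F. n \<le> a) \<and> F \<in> schreier fs (fs \<xi> n)}"
  using assms unfolding fundamental_sequences_def is_limit_def
  by (subst schreier.simps) (auto simp: one_countable_ordinal_def)

class complex_banach = banach +
  fixes scaleC :: "complex \<Rightarrow> 'a \<Rightarrow> 'a" (infixr "*\<^sub>C" 75)
  assumes scaleC_add_right: "c *\<^sub>C (x + y) = c *\<^sub>C x + c *\<^sub>C y"
    and scaleC_add_left: "(c + d) *\<^sub>C x = c *\<^sub>C x + d *\<^sub>C x"
    and scaleC_scaleC: "c *\<^sub>C d *\<^sub>C x = (c * d) *\<^sub>C x"
    and scaleR_scaleC: "r *\<^sub>R x = complex_of_real r *\<^sub>C x"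
    and norm_scaleC: "norm (c *\<^sub>C x) = cmod c * norm x"

global_interpretation complex_vector: vector_space "scaleC :: complex \<Rightarrow> 'a \<Rightarrow> 'a :: complex_banach"
proof
  show "1 *\<^sub>C x = x" for x :: 'a
    using scaleR_scaleC[of 1 x] by simp
qed (simp_all add: scaleC_add_right scaleC_add_left scaleC_scaleC)

definition closed_csubspace :: "'a::complex_banach set \<Rightarrow> bool" where
  "closed_csubspace Y \<longleftrightarrow> complex_vector.subspace Y \<and> closed Y"

definition closed_cspan :: "'a::complex_banach set \<Rightarrow> 'a set" where
  "closed_cspan A = closure (complex_vector.span A)"

definition infinite_cdim :: "'a::complex_banach set \<Rightarrow> bool" where
  "infinite_cdim Y \<longleftrightarrow> \<not> (\<exists>B. finite B \<and> B \<subseteq> Y \<and> complex_vector.span B = Y)"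

text \<open>Sequences are indexed by \<open>1, 2, \<dots>\<close>, so \<open>x 0\<close> plays no role. A basic sequence is a Schauder basis
  of its closed linear span; \<open>a n\<close> is the coefficient of \<open>x (Suc n)\<close>.\<close>

definition basic_sequence :: "(nat \<Rightarrow> 'a::complex_banach) \<Rightarrow> bool" where
  "basic_sequence x \<longleftrightarrow>
     (\<forall>y\<in>closed_cspan (x ` {1..}). \<exists>!a :: nat \<Rightarrow> complex. (\<lambda>n. a n *\<^sub>C x (Suc n)) sums y)"

text \<open>\<open>L(Y, X)\<close> for a subspace \<open>Y\<close>; values of the operator off \<open>Y\<close> are irrelevant.\<close>

definition bounded_clinear_on ::
  "'a::complex_banach set \<Rightarrow> ('a \<Rightarrow> 'b::complex_banach) \<Rightarrow> bool" where
  "bounded_clinear_on Y T \<longleftrightarrow>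
     (\<forall>x\<in>Y. \<forall>y\<in>Y. T (x + y) = T x + T y) \<and>
     (\<forall>c. \<forall>x\<in>Y. T (c *\<^sub>C x) = c *\<^sub>C T x) \<and>
     (\<exists>K. \<forall>x\<in>Y. norm (T x) \<le> K * norm x)"

definition hereditarily_indecomposable :: "nat set set \<Rightarrow> 'a::complex_banach itself \<Rightarrow> bool" where
  "hereditarily_indecomposable \<F> (_ :: 'a itself) \<longleftrightarrow>
     (\<forall>\<epsilon>>0. \<forall>(Z :: 'a set) (x :: nat \<Rightarrow> 'a).
        closed_csubspace Z \<and> infinite_cdim Z \<and> basic_sequence x \<longrightarrow>
        (\<exists>F\<in>\<F>. \<exists>z\<in>Z. norm z = 1 \<and> infdist z (closed_cspan (x ` F)) < \<epsilon>))"

definition strictly_singular ::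
  "nat set set \<Rightarrow> 'a::complex_banach set \<Rightarrow> ('a \<Rightarrow> 'b::complex_banach) \<Rightarrow> bool" where
  "strictly_singular \<F> Y S \<longleftrightarrow>
     bounded_clinear_on Y S \<and>
     (\<forall>\<epsilon>>0. \<forall>x :: nat \<Rightarrow> 'a.
        basic_sequence x \<and> (\<forall>n\<ge>1. x n \<in> Y) \<longrightarrow>
        (\<exists>F\<in>\<F>. \<exists>z\<in>closed_cspan (x ` F) - {0}. norm (S z) \<le> \<epsilon> * norm z))"

end

theory Submission
  imports Defs
begin

text \<open>Put \<open>S = T - \<mu>\<close>. If for every \<open>\<epsilon> > 0\<close> there is an infinite-dimensional subspace
  \<open>V \<subseteq> Y\<close> with \<open>\<parallel>S v\<parallel> \<le> \<epsilon> \<parallel>v\<parallel>\<close> on \<open>V\<close>, then \<open>S\<close> is strictly singular in the quantified sense: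
  given a basic sequence \<open>x\<close>, hereditary indecomposability applied to \<open>V\<close> and \<open>x\<close> yields an admissible
  set \<open>F\<close> and a vector of \<open>[x\<^sub>i]\<^sub>i\<^sub>\<in>\<^sub>F\<close> close to a unit vector of \<open>V\<close>, and \<open>S\<close> is small there too. So
  the whole matter is to find one scalar \<open>\<mu>\<close> at which \<open>T - \<mu>\<close> is arbitrarily small on
  infinite-dimensional subspaces (\<open>hereditarily_indecomposable_approximate_eigenvalue\<close>). As \<open>T\<close>
  need not map \<open>Y\<close> into itself, this \<open>\<mu>\<close> cannot simply be taken from the spectrum of \<open>T\<close>; the proof
  transplants the argument that a spectrum is nonempty.

  Suppose that there is no such \<open>\<mu>\<close>. Mazur's construction of basic sequences turns the failure at
  \<open>\<mu>\<close> into a lower bound for \<open>T - \<mu>\<close> on a subspace of finite codimension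
  (\<open>bounded_below_on_finite_codim\<close>), and compactness of a disc, outside of which \<open>T - \<mu>\<close> is bounded
  below for trivial reasons, makes the subspace \<open>V\<close> and the bound independent of \<open>\<mu>\<close>. The images
  \<open>(T - \<mu>) V\<close> are infinite-dimensional. In a hereditarily indecomposable space finitely many such
  subspaces come arbitrarily close to a common unit vector \<open>v\<close>
  (\<open>hereditarily_indecomposable_common_nearby\<close>), so for every finite set of scalars there are vectors
  \<open>y\<^sub>\<mu> \<in> V\<close> with \<open>(T - \<mu>) y\<^sub>\<mu>\<close> as close to \<open>v\<close> as desired: approximate values of a resolvent applied to
  one vector.

  A finite grid of such values is already contradictory (\<open>no_bounded_approximate_resolvent\<close>). By the
  resolvent identity and the uniform lower bound, \<open>\<mu> \<mapsto> y\<^sub>\<mu>\<close> has bounded divided differences of first and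
  second order, so the discrete contour sum around a grid cell of side \<open>h\<close> is \<open>O(h\<^sup>3)\<close>, and the sum
  around a large square is \<open>O(h)\<close>. But on that square \<open>y\<^sub>\<mu>\<close> is nearly \<open>- v / \<mu>\<close>, whose contour sum stays
  away from \<open>0\<close>.\<close>


section \<open>Closed complex subspaces\<close>

text \<open>Makes the limit and continuity rules for bilinear operations available for complex scalars.\<close>

lemma bounded_bilinear_scaleC: "bounded_bilinear (scaleC :: complex \<Rightarrow> 'a \<Rightarrow> 'a::complex_banach)"
proof
  show "(r *\<^sub>R c) *\<^sub>C x = r *\<^sub>R (c *\<^sub>C x)" for r c and x :: 'a
    by (simp add: scaleR_scaleC scaleC_scaleC scaleR_conv_of_real)
  show "c *\<^sub>C (r *\<^sub>R x) = r *\<^sub>R (c *\<^sub>C x)" for r c and x :: 'a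
    by (simp add: scaleR_scaleC scaleC_scaleC mult.commute)
  show "\<exists>K. \<forall>c (x::'a). norm (c *\<^sub>C x) \<le> norm c * norm x * K"
    by (rule exI[of _ 1]) (simp add: norm_scaleC)
qed (simp_all add: scaleC_add_left scaleC_add_right)

lemmas tendsto_scaleC [tendsto_intros] = bounded_bilinear.tendsto[OF bounded_bilinear_scaleC]
lemmas continuous_on_scaleC [continuous_intros] = bounded_bilinear.continuous_on[OF bounded_bilinear_scaleC]

lemma csubspace_closure:
  fixes A :: "'a::complex_banach set"
  assumes "complex_vector.subspace A"
  shows "complex_vector.subspace (closure A)"
proof (rule complex_vector.subspaceI)
  show "0 \<in> closure A"
    using complex_vector.subspace_0[OF assms] closure_subset by blast
  show "x + y \<in> closure A" if "x \<in> closure A" "y \<in> closure A" for x y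
  proof -
    obtain u v where "\<And>n. u n \<in> A" "u \<longlonglongrightarrow> x" "\<And>n. v n \<in> A" "v \<longlonglongrightarrow> y"
      using \<open>x \<in> closure A\<close> \<open>y \<in> closure A\<close> unfolding closure_sequential by metis
    then show ?thesis
      unfolding closure_sequential
      by (intro exI[of _ "\<lambda>n. u n + v n"]) (auto intro: tendsto_intros complex_vector.subspace_add[OF assms])
  qed
  show "c *\<^sub>C x \<in> closure A" if "x \<in> closure A" for c x
  proof -
    obtain u where "\<And>n. u n \<in> A" "u \<longlonglongrightarrow> x"
      using \<open>x \<in> closure A\<close> unfolding closure_sequential by metis
    then show ?thesis
      unfolding closure_sequential
      by (intro exI[of _ "\<lambda>n. c *\<^sub>C u n"]) (auto intro: tendsto_intros complex_vector.subspace_scale[OF assms])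
  qed
qed

lemma closed_csubspace_closed_cspan: "closed_csubspace (closed_cspan A)"
  unfolding closed_csubspace_def closed_cspan_def by (simp add: csubspace_closure)

lemma closed_cspan_minimal:
  assumes "A \<subseteq> W" "closed_csubspace W"
  shows "closed_cspan A \<subseteq> W"
  using assms unfolding closed_csubspace_def closed_cspan_def
  by (intro closure_minimal complex_vector.span_minimal) auto

lemma closed_csubspace_Int: "closed_csubspace A \<Longrightarrow> closed_csubspace B \<Longrightarrow> closed_csubspace (A \<inter> B)"
  unfolding closed_csubspace_def by (simp add: complex_vector.subspace_inter closed_Int)

section \<open>The Hahn-Banach theorem and common kernels\<close>

text \<open>Zorn's lemma is applied to graphs, that is, to subspaces of \<open>X \<times> \<real>\<close> in which every pair
  \<open>(x, r)\<close> satisfies \<open>r \<le> \<parallel>x\<parallel>\<close>. This inequality alone makes such a subspace a single-valued graph: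
  \<open>(0, r)\<close> and \<open>(0, - r)\<close> both lie in it if one does, whence \<open>r = 0\<close>.\<close>

lemma hahn_banach_norming:
  fixes y :: "'a::real_normed_vector"
  obtains g :: "'a \<Rightarrow> real" where "linear g" "\<And>x. g x \<le> norm x" "g y = norm y"
proof -
  define A where "A = {G :: ('a \<times> real) set. subspace G \<and> (\<forall>(x, r)\<in>G. r \<le> norm x) \<and> (y, norm y) \<in> G}"
  have "span {(y, norm y)} \<in> A"
  proof -
    have "t * norm y \<le> norm (t *\<^sub>R y)" for t
      by (simp add: mult_right_mono)
    then have "r \<le> norm x" if "(x, r) \<in> span {(y, norm y)}" for x r
      using that by (auto simp: span_singleton)
    moreover have "(y, norm y) \<in> span {(y, norm y)}" by (simp add: span_base)
    ultimately show ?thesis unfolding A_def using subspace_span by blast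
  qed
  then have "A \<noteq> {}" by blast
  moreover have "\<Union>C \<in> A" if "C \<noteq> {}" and ch: "subset.chain A C" for C
  proof -
    have CA: "C \<subseteq> A" using ch by (simp add: subset.chain_def)
    then have subC: "subspace G" if "G \<in> C" for G using that by (auto simp: A_def)
    have "subspace (\<Union>C)"
    proof (rule subspaceI)
      show "0 \<in> \<Union>C" using \<open>C \<noteq> {}\<close> subspace_0[OF subC] by blast
      show "c *\<^sub>R p \<in> \<Union>C" if "p \<in> \<Union>C" for c p
        using that subspace_scale[OF subC] by blast
      fix p p' assume "p \<in> \<Union>C" "p' \<in> \<Union>C"
      then obtain G G' where G: "G \<in> C" "G' \<in> C" "p \<in> G" "p' \<in> G'" by blast
      then have "G \<subseteq> G' \<or> G' \<subseteq> G" using ch unfolding subset.chain_def by blast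
      then show "p + p' \<in> \<Union>C"
      proof
        assume "G \<subseteq> G'"
        then have "p + p' \<in> G'" using G by (intro subspace_add[OF subC]) auto
        then show ?thesis using G by blast
      next
        assume "G' \<subseteq> G"
        then have "p + p' \<in> G" using G by (intro subspace_add[OF subC]) auto
        then show ?thesis using G by blast
      qed
    qed
    moreover have "r \<le> norm x" if "(x, r) \<in> \<Union>C" for x r using that CA by (auto simp: A_def)
    moreover have "(y, norm y) \<in> \<Union>C" using CA \<open>C \<noteq> {}\<close> by (auto simp: A_def)
    ultimately show ?thesis unfolding A_def by blast
  qed
  ultimately obtain M where "M \<in> A" and max: "\<And>G. G \<in> A \<Longrightarrow> M \<subseteq> G \<Longrightarrow> G = M"
    using subset_Zorn_nonempty[of A] by metis
  then have sub: "subspace M" and le: "\<And>x r. (x, r) \<in> M \<Longrightarrow> r \<le> norm x" and yM: "(y, norm y) \<in> M"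
    by (auto simp: A_def)
  have scaleM: "(t *\<^sub>R x, t * r) \<in> M" if "(x, r) \<in> M" for t x r
    using subspace_scale[OF sub that, of t] by simp
  have diffM: "(x - x', r - r') \<in> M" if "(x, r) \<in> M" "(x', r') \<in> M" for x x' r r'
    using subspace_diff[OF sub that] by simp
  have addM: "(x + x', r + r') \<in> M" if "(x, r) \<in> M" "(x', r') \<in> M" for x x' r r'
    using subspace_add[OF sub that] by simp
  have total: "\<exists>r. (x0, r) \<in> M" for x0
  proof -
    define B where "B = {r - norm (x - x0) | x r. (x, r) \<in> M}"
    \<comment> \<open>A value at \<open>x0\<close> is admissible iff it lies between all \<open>r - \<parallel>x - x0\<parallel>\<close> and all \<open>\<parallel>x + x0\<parallel> - r\<close>.\<close>
    define \<alpha> where "\<alpha> = Sup B"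
    have bound: "b \<le> norm (x' + x0) - r'" if "b \<in> B" "(x', r') \<in> M" for b x' r'
    proof -
      obtain x r where b: "b = r - norm (x - x0)" "(x, r) \<in> M" using \<open>b \<in> B\<close> by (auto simp: B_def)
      have "r + r' \<le> norm (x + x')" using le addM[OF b(2) that(2)] by blast
      also have "\<dots> = norm ((x - x0) + (x' + x0))" by simp
      also have "\<dots> \<le> norm (x - x0) + norm (x' + x0)" by (rule norm_triangle_ineq)
      finally show ?thesis using b by simp
    qed
    have "B \<noteq> {}" using yM by (auto simp: B_def)
    have up: "r + \<alpha> \<le> norm (x + x0)" if "(x, r) \<in> M" for x r
      using cSup_least[OF \<open>B \<noteq> {}\<close>, of "norm (x + x0) - r"] bound[OF _ that] by (simp add: \<alpha>_def)
    have "bdd_above B" using bound[OF _ yM] by (intro bdd_aboveI)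
    have down: "r - \<alpha> \<le> norm (x - x0)" if "(x, r) \<in> M" for x r
    proof -
      have "r - norm (x - x0) \<in> B" using that by (auto simp: B_def)
      then show ?thesis using cSup_upper \<open>bdd_above B\<close> by (fastforce simp: \<alpha>_def)
    qed
    have dom: "s \<le> norm u" if us: "(u, s) \<in> span (insert (x0, \<alpha>) M)" for u s
    proof -
      obtain k where k: "(u - k *\<^sub>R x0, s - k * \<alpha>) \<in> M"
        using us span_breakdown_eq[of "(u, s)" "(x0, \<alpha>)" M] sub by (auto simp: span_eq_iff[THEN iffD2])
      \<comment> \<open>Scaling by \<open>1 / \<bar>k\<bar>\<close> reduces to the coefficients \<open>1\<close> and \<open>-1\<close> of \<open>x0\<close>.\<close>
      consider "k = 0" | "k > 0" | "k < 0" by linarith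
      then show ?thesis
      proof cases
        case 1 then show ?thesis using le k by simp
      next
        case 2
        have "(1 / k) * (s - k * \<alpha>) + \<alpha> \<le> norm ((1 / k) *\<^sub>R (u - k *\<^sub>R x0) + x0)"
          by (rule up[OF scaleM[OF k]])
        also have "(1 / k) *\<^sub>R (u - k *\<^sub>R x0) + x0 = (1 / k) *\<^sub>R u"
          using 2 by (simp add: algebra_simps)
        finally show ?thesis using 2 by (simp add: field_simps)
      next
        case 3
        have "(-1 / k) * (s - k * \<alpha>) - \<alpha> \<le> norm ((-1 / k) *\<^sub>R (u - k *\<^sub>R x0) - x0)"
          by (rule down[OF scaleM[OF k]])
        also have "(-1 / k) *\<^sub>R (u - k *\<^sub>R x0) - x0 = (-1 / k) *\<^sub>R u"
          using 3 by (simp add: algebra_simps)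
        finally show ?thesis using 3 by (simp add: field_simps)
      qed
    qed
    have ins: "insert (x0, \<alpha>) M \<subseteq> span (insert (x0, \<alpha>) M)" by (rule span_superset)
    then have "span (insert (x0, \<alpha>) M) \<in> A" unfolding A_def
      using dom yM by (intro CollectI conjI subspace_span) auto
    then have "span (insert (x0, \<alpha>) M) = M" using max ins by blast
    then show ?thesis using ins by blast
  qed
  define g where "g x = (SOME r. (x, r) \<in> M)" for x
  have gM: "(x, g x) \<in> M" for x unfolding g_def using total by (rule someI_ex)
  have uniq: "r = r'" if "(x, r) \<in> M" "(x, r') \<in> M" for x r r'
    using le[OF diffM[OF that]] le[OF diffM[OF that(2,1)]] by simp
  have "g (x + x') = g x + g x'" for x x' using uniq[OF gM addM[OF gM gM]] .
  moreover have "g (c *\<^sub>R x) = c *\<^sub>R g x" for c x using uniq[OF gM scaleM[OF gM]] by simp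
  ultimately have "linear g" by (intro linearI)
  moreover have "g y = norm y" using uniq[OF gM yM] .
  ultimately show ?thesis using that le gM by blast
qed

definition bounded_functional :: "('a::complex_banach \<Rightarrow> complex) \<Rightarrow> bool" where
  "bounded_functional f \<longleftrightarrow>
     (\<forall>x y. f (x + y) = f x + f y) \<and> (\<forall>c x. f (c *\<^sub>C x) = c * f x) \<and> (\<exists>K. \<forall>x. cmod (f x) \<le> K * norm x)"

text \<open>The real functional \<open>g\<close> is the real part of the complex functional \<open>x \<mapsto> g(x) - \<i> g(\<i> x)\<close>.\<close>

lemma bounded_functional_exists_norming:
  fixes y :: "'a::complex_banach"
  obtains f :: "'a \<Rightarrow> complex" where "bounded_functional f" "\<And>x. Re (f x) \<le> norm x" "Re (f y) = norm y"
proof -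
  obtain g :: "'a \<Rightarrow> real" where g: "linear g" "\<And>x. g x \<le> norm x" "g y = norm y"
    using hahn_banach_norming by blast
  define f where "f x = Complex (g x) (- g (\<i> *\<^sub>C x))" for x
  have add: "g (u + v) = g u + g v" for u v using g(1) by (rule linear_add)
  have scale: "g (complex_of_real r *\<^sub>C u) = r * g u" for r u
    using linear_scale[OF g(1), of r u] by (simp add: scaleR_scaleC)
  have gc: "g (c *\<^sub>C x) = Re c * g x + Im c * g (\<i> *\<^sub>C x)" for c x
  proof -
    have "c *\<^sub>C x = complex_of_real (Re c) *\<^sub>C x + complex_of_real (Im c) *\<^sub>C (\<i> *\<^sub>C x)"
      unfolding scaleC_scaleC scaleC_add_left[symmetric] by (metis complex_eq mult.commute)
    then have "g (c *\<^sub>C x) = g (complex_of_real (Re c) *\<^sub>C x) + g (complex_of_real (Im c) *\<^sub>C (\<i> *\<^sub>C x))"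
      by (simp only: add)
    then show ?thesis by (simp only: scale)
  qed
  have ng: "\<bar>g x\<bar> \<le> norm x" for x
    using g(2)[of x] g(2)[of "- x"] linear_neg[OF g(1), of x] by (simp add: abs_le_iff)
  have "f (u + v) = f u + f v" for u v
    by (simp add: f_def add scaleC_add_right complex_eq_iff)
  moreover have "f (c *\<^sub>C x) = c * f x" for c x
    using gc[of "c" x] gc[of "\<i> * c" x]
    by (simp add: f_def complex_eq_iff scaleC_scaleC algebra_simps)
  moreover have "cmod (f x) \<le> 2 * norm x" for x
    using cmod_le[of "f x"] ng[of x] ng[of "\<i> *\<^sub>C x"] by (simp add: f_def norm_scaleC)
  ultimately have "bounded_functional f" unfolding bounded_functional_def by blast
  then show ?thesis using that g by (simp add: f_def)
qed

lemma bounded_functional_tendsto: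
  assumes "bounded_functional f" "u \<longlonglongrightarrow> x"
  shows "(\<lambda>n. f (u n)) \<longlonglongrightarrow> f x"
proof -
  obtain K where K: "\<And>x. cmod (f x) \<le> K * norm x" using assms(1) by (auto simp: bounded_functional_def)
  have diff: "f a - f b = f (a - b)" for a b
    using assms(1) unfolding bounded_functional_def by (metis diff_add_cancel add_diff_cancel_right')
  have "(\<lambda>n. K * norm (u n - x)) \<longlonglongrightarrow> K * norm (x - x)" by (intro tendsto_intros assms(2))
  then have "(\<lambda>n. K * norm (u n - x)) \<longlonglongrightarrow> 0" by simp
  then have "(\<lambda>n. f (u n) - f x) \<longlonglongrightarrow> 0"
    by (rule Lim_null_comparison[rotated]) (simp add: diff K)
  then show ?thesis by (rule LIM_zero_cancel)
qed

text \<open>For a finite set of bounded functionals this is a closed subspace of finite codimension; subspaces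
  of finite codimension are always presented in this form.\<close>

definition common_kernel :: "('a::complex_banach \<Rightarrow> complex) set \<Rightarrow> 'a set" where
  "common_kernel \<Phi> = {x. \<forall>f\<in>\<Phi>. f x = 0}"

lemma common_kernel_Un: "common_kernel (\<Phi> \<union> \<Psi>) = common_kernel \<Phi> \<inter> common_kernel \<Psi>"
  by (auto simp: common_kernel_def)

lemma closed_csubspace_common_kernel:
  assumes "\<forall>f\<in>\<Phi>. bounded_functional f"
  shows "closed_csubspace (common_kernel \<Phi>)"
  unfolding closed_csubspace_def
proof
  have "f 0 = 0" if "f \<in> \<Phi>" for f
    using assms that unfolding bounded_functional_def by (metis add_cancel_right_right)
  moreover have "f (x + y) = 0" if "f \<in> \<Phi>" "f x = 0" "f y = 0" for f x y
  proof -
    have "f (x + y) = f x + f y" using assms that(1) unfolding bounded_functional_def by blast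
    then show ?thesis using that by simp
  qed
  moreover have "f (c *\<^sub>C x) = 0" if "f \<in> \<Phi>" "f x = 0" for f c x
  proof -
    have "f (c *\<^sub>C x) = c * f x" using assms that(1) unfolding bounded_functional_def by blast
    then show ?thesis using that by simp
  qed
  ultimately show "complex_vector.subspace (common_kernel \<Phi>)"
    unfolding common_kernel_def by (intro complex_vector.subspaceI CollectI ballI) blast+
  show "closed (common_kernel \<Phi>)"
    unfolding closed_sequential_limits
  proof (intro allI impI, elim conjE)
    fix u x assume u: "\<forall>n. u n \<in> common_kernel \<Phi>" "u \<longlonglongrightarrow> x"
    have "f x = 0" if "f \<in> \<Phi>" for f
    proof -
      have "(\<lambda>n. f (u n)) \<longlonglongrightarrow> f x" using bounded_functional_tendsto assms that u by blast
      moreover have "f (u n) = 0" for n using u that by (simp add: common_kernel_def)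
      ultimately show ?thesis by (simp add: LIMSEQ_const_iff)
    qed
    then show "x \<in> common_kernel \<Phi>" by (simp add: common_kernel_def)
  qed
qed

text \<open>If the kernel of \<open>f\<close> in \<open>W\<close> were spanned by a finite set, adding one vector outside the kernel
  would give a finite spanning set of \<open>W\<close>.\<close>

lemma infinite_cdim_Int_common_kernel:
  assumes "finite \<Phi>" "\<forall>f\<in>\<Phi>. bounded_functional f"
    and "complex_vector.subspace W" "infinite_cdim W"
  shows "infinite_cdim (W \<inter> common_kernel \<Phi>)"
  using assms
proof (induction \<Phi> arbitrary: W rule: finite_induct)
  case empty then show ?case by (simp add: common_kernel_def)
next
  case (insert f \<Phi>)
  let ?V = "W \<inter> common_kernel {f}"
  have ck: "complex_vector.subspace (common_kernel {f})"
    using closed_csubspace_common_kernel[of "{f}"] insert.prems by (simp add: closed_csubspace_def)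
  have "infinite_cdim ?V"
    unfolding infinite_cdim_def
  proof (intro notI, elim exE conjE)
    fix B assume B: "finite B" "B \<subseteq> ?V" "complex_vector.span B = ?V"
    then obtain w where w: "w \<in> W" "f w \<noteq> 0"
    proof -
      have "?V \<noteq> W"
        using B insert.prems(3) unfolding infinite_cdim_def by blast
      then show ?thesis using that by (auto simp: common_kernel_def)
    qed
    have "complex_vector.span (insert w B) = W"
    proof (rule complex_vector.span_subspace)
      show "insert w B \<subseteq> W" using B w by blast
      show "complex_vector.subspace W" by fact
      show "W \<subseteq> complex_vector.span (insert w B)"
      proof
        fix u assume "u \<in> W"
        define k where "k = f u / f w"
        have "f (u - k *\<^sub>C w) = f u - k * f w"
          using insert.prems(1) unfolding bounded_functional_def
          by (metis insertI1 add_diff_cancel_right' diff_add_cancel)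
        then have "u - k *\<^sub>C w \<in> complex_vector.span B"
          using B(3) w \<open>u \<in> W\<close> insert.prems(2)
          by (simp add: common_kernel_def k_def complex_vector.subspace_diff complex_vector.subspace_scale)
        then show "u \<in> complex_vector.span (insert w B)"
          unfolding complex_vector.span_breakdown_eq by blast
      qed
    qed
    moreover have "finite (insert w B)" "insert w B \<subseteq> W" using B w by auto
    ultimately show False using insert.prems(3) unfolding infinite_cdim_def by blast
  qed
  then have "infinite_cdim (?V \<inter> common_kernel \<Phi>)"
    using insert.prems ck by (intro insert.IH) (auto intro: complex_vector.subspace_inter)
  then show ?case
    using common_kernel_Un[of "{f}" \<Phi>] by (simp add: Int_assoc)
qed

section \<open>Finite-dimensional subspaces\<close>

text \<open>Closedness comes from compactness of all balls: a convergent sequence is bounded.\<close>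

lemma compact_unit_ball_imp_compact_closed:
  fixes V :: "'a::complex_banach set"
  assumes "complex_vector.subspace V" "compact (V \<inter> cball 0 1)"
  shows "compact (V \<inter> cball 0 r)" "closed V"
proof -
  show cpt: "compact (V \<inter> cball 0 r)" for r
  proof -
    define s where "s = max 1 r"
    have s: "s > 0" "r \<le> s" by (auto simp: s_def)
    have "compact ((\<lambda>x. s *\<^sub>R x) ` (V \<inter> cball 0 1))"
      by (rule compact_scaling[OF assms(2)])
    moreover have "V \<inter> cball 0 r \<subseteq> (\<lambda>x. s *\<^sub>R x) ` (V \<inter> cball 0 1)"
    proof
      fix x assume x: "x \<in> V \<inter> cball 0 r"
      have "(1 / s) *\<^sub>R x \<in> V \<inter> cball 0 1"
        using x s by (auto simp: scaleR_scaleC complex_vector.subspace_scale[OF assms(1)] norm_scaleC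
            norm_divide divide_simps)
      then show "x \<in> (\<lambda>x. s *\<^sub>R x) ` (V \<inter> cball 0 1)"
        using s by (intro image_eqI[of _ _ "(1 / s) *\<^sub>R x"]) auto
    qed
    moreover have "V \<inter> cball 0 r = (\<lambda>x. s *\<^sub>R x) ` (V \<inter> cball 0 1) \<inter> cball 0 r"
      using calculation(2) by (auto simp: scaleR_scaleC complex_vector.subspace_scale[OF assms(1)])
    ultimately show ?thesis by (metis closed_cball compact_Int_closed)
  qed
  show "closed V"
    unfolding closed_sequential_limits
  proof (intro allI impI, elim conjE)
    fix u x assume u: "\<forall>n. u n \<in> V" "u \<longlonglongrightarrow> x"
    then obtain r where r: "\<And>n. norm (u n) \<le> r"
      using convergent_imp_Bseq[of u] by (auto simp: convergent_def Bseq_def)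
    then have "\<forall>n. u n \<in> V \<inter> cball 0 r" using u by simp
    then show "x \<in> V" using compact_imp_closed[OF cpt[of r]] u(2) unfolding closed_sequential_limits by blast
  qed
qed

text \<open>Induction on the number of generators. For a new generator \<open>b\<close> at distance \<open>d > 0\<close> from the span
  of the old ones, the coefficient of \<open>b\<close> in a vector \<open>x\<close> is at most \<open>\<parallel>x\<parallel> / d\<close>, so the unit ball lies in
  the sum of two compact sets.\<close>

lemma compact_cspan_unit_ball:
  fixes B :: "'a::complex_banach set"
  assumes "finite B"
  shows "compact (complex_vector.span B \<inter> cball 0 1)"
  using assms
proof (induction rule: finite_induct)
  case empty then show ?case by simp
next
  case (insert b B)
  let ?V = "complex_vector.span B" and ?V' = "complex_vector.span (insert b B)"
  have V: "complex_vector.subspace ?V" by simp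
  note cpt = compact_unit_ball_imp_compact_closed[OF V insert.IH]
  show ?case
  proof (cases "b \<in> ?V")
    case True then show ?thesis using insert.IH complex_vector.span_redundant by metis
  next
    case False
    define d where "d = infdist b ?V"
    have "d > 0"
      unfolding d_def using cpt(2) False complex_vector.span_zero[of B]
      by (intro infdist_pos_not_in_closed) auto
    define L where "L = {s + a | s a. s \<in> ?V \<inter> cball 0 (1 + norm b / d) \<and> a \<in> (\<lambda>k. k *\<^sub>C b) ` cball 0 (1 / d)}"
    have "compact L"
      unfolding L_def
      by (intro compact_sums cpt(1) compact_continuous_image continuous_intros compact_cball)
    have "?V' \<inter> cball 0 1 = L \<inter> cball 0 1"
    proof (intro equalityI subsetI IntI; (elim IntE)?)
      fix x assume x: "x \<in> ?V'" "x \<in> cball 0 1"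
      obtain k where k: "x - k *\<^sub>C b \<in> ?V" using x(1) complex_vector.span_breakdown_eq by metis
      have "cmod k * d \<le> norm x"
      proof (cases "k = 0")
        case False
        have "(- 1 / k) *\<^sub>C (x - k *\<^sub>C b) \<in> ?V" by (rule complex_vector.span_scale[OF k])
        then have "d \<le> norm (b - (- 1 / k) *\<^sub>C (x - k *\<^sub>C b))"
          unfolding d_def dist_norm[symmetric] by (rule infdist_le)
        also have "b - (- 1 / k) *\<^sub>C (x - k *\<^sub>C b) = (1 / k) *\<^sub>C x"
          using False by (simp add: complex_vector.scale_right_diff_distrib scaleC_scaleC)
        finally show ?thesis using False by (simp add: norm_scaleC norm_divide field_simps)
      qed simp
      then have "cmod k * d \<le> 1" using x(2) by simp
      then have kd: "cmod k \<le> 1 / d" using \<open>d > 0\<close> by (simp add: field_simps)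
      then have "norm (k *\<^sub>C b) \<le> norm b / d"
        unfolding norm_scaleC using mult_right_mono[OF kd, of "norm b"] by simp
      then have "norm (x - k *\<^sub>C b) \<le> 1 + norm b / d"
        using norm_triangle_ineq4[of x "k *\<^sub>C b"] x(2) by simp
      then show "x \<in> L" unfolding L_def using k kd
        by (intro CollectI exI[of _ "x - k *\<^sub>C b"] exI[of _ "k *\<^sub>C b"]) auto
    next
      fix x assume "x \<in> L"
      then obtain s k where "s \<in> ?V" "x = s + k *\<^sub>C b" by (auto simp: L_def)
      then show "x \<in> ?V'" unfolding complex_vector.span_breakdown_eq by (intro exI[of _ k]) simp
    qed auto
    then show ?thesis using \<open>compact L\<close> by (simp add: compact_Int_closed)
  qed
qed

text \<open>Mazur's lemma: norming functionals of a finite \<open>\<epsilon>\<close>-net of the unit sphere of the span cut out a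
  subspace of finite codimension that is almost orthogonal to the span.\<close>

lemma mazur_finite_codim:
  fixes B :: "'a::complex_banach set"
  assumes "finite B" "\<epsilon> > 0"
  obtains \<Phi> where "finite \<Phi>" "\<forall>f\<in>\<Phi>. bounded_functional f"
    "\<And>x y. y \<in> complex_vector.span B \<Longrightarrow> x \<in> common_kernel \<Phi> \<Longrightarrow> (1 - \<epsilon>) * norm y \<le> norm (y + x)"
proof -
  let ?V = "complex_vector.span B"
  have "compact ((?V \<inter> cball 0 1) \<inter> {x. norm x = 1})"
    using compact_cspan_unit_ball[OF assms(1)] by (rule compact_Int_closed) (intro closed_Collect_eq continuous_intros)
  then obtain k where k: "finite k" "(?V \<inter> cball 0 1) \<inter> {x. norm x = 1} \<subseteq> (\<Union>y\<in>k. ball y \<epsilon>)" "k \<subseteq> (?V \<inter> cball 0 1) \<inter> {x. norm x = 1}"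
    by (metis seq_compact_imp_totally_bounded compact_imp_seq_compact assms(2))
  have "\<forall>y::'a. \<exists>f. bounded_functional f \<and> (\<forall>x. Re (f x) \<le> norm x) \<and> Re (f y) = norm y"
    using bounded_functional_exists_norming by metis
  then obtain F where F: "\<And>y::'a. bounded_functional (F y)" "\<And>y x. Re (F y x) \<le> norm x" "\<And>y. Re (F y y) = norm y"
    by metis
  have unit: "1 - \<epsilon> \<le> norm (y + x)" if y: "y \<in> ?V" "norm y = 1" "x \<in> common_kernel (F ` k)" for x y
  proof -
    have "y \<in> (?V \<inter> cball 0 1) \<inter> {x. norm x = 1}" using y by simp
    then have "y \<in> (\<Union>y\<in>k. ball y \<epsilon>)" using k(2) by blast
    then obtain z where z: "z \<in> k" "dist z y < \<epsilon>" by auto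
    then have "norm z = 1" using k(3) by auto
    have "F z (z + x) = F z z + F z x" using F(1) by (simp add: bounded_functional_def)
    moreover have "F z x = 0" using y(3) z by (simp add: common_kernel_def)
    ultimately have "1 \<le> norm (z + x)" using F(2)[of z "z + x"] F(3)[of z] \<open>norm z = 1\<close> by simp
    also have "\<dots> = norm ((y + x) + (z - y))" by (simp add: add.commute)
    also have "\<dots> \<le> norm (y + x) + norm (z - y)" by (rule norm_triangle_ineq)
    finally show ?thesis using z(2) by (simp add: dist_norm)
  qed
  have sub: "complex_vector.subspace (common_kernel (F ` k))"
    using closed_csubspace_common_kernel[of "F ` k"] F(1) by (auto simp: closed_csubspace_def)
  have "(1 - \<epsilon>) * norm y \<le> norm (y + x)" if "y \<in> ?V" "x \<in> common_kernel (F ` k)" for x y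
  proof (cases "y = 0")
    case False
    define t where "t = complex_of_real (1 / norm y)"
    have "1 - \<epsilon> \<le> norm (t *\<^sub>C y + t *\<^sub>C x)"
      using that False
      by (intro unit complex_vector.span_scale complex_vector.subspace_scale[OF sub]) (auto simp: norm_scaleC t_def norm_divide)
    also have "\<dots> = norm (y + x) / norm y"
      unfolding scaleC_add_right[symmetric] by (simp add: norm_scaleC t_def norm_divide)
    finally show ?thesis using False by (simp add: field_simps)
  qed simp
  then show ?thesis using that[of "F ` k"] k(1) F(1) by auto
qed

section \<open>Basic sequences on which a seminorm is small\<close>

text \<open>Any strictly increasing sequence with values in \<open>[1, 2]\<close> would do: the quotients of consecutive terms are
  the losses permitted in the single steps of Mazur's construction, and their products telescope.\<close>

definition growth :: "nat \<Rightarrow> real" where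
  "growth n = 2 - 1 / (real n + 1)"

lemma growth_bounds: "1 \<le> growth n" "growth n \<le> 2" "growth n < growth (Suc n)"
  by (simp_all add: growth_def field_simps)

text \<open>A normalized sequence whose partial sum projections have norm at most \<open>2\<close>. The defining condition
  concerns one step at a time, so that such sequences can be built recursively.\<close>

definition mazur_sequence :: "(nat \<Rightarrow> 'a::complex_banach) \<Rightarrow> bool" where
  "mazur_sequence e \<longleftrightarrow> (\<forall>n. norm (e n) = 1) \<and>
     (\<forall>n c. \<forall>y\<in>complex_vector.span (e ` {..<n}).
        growth n * norm y \<le> growth (Suc n) * norm (y + c *\<^sub>C e n))"

lemma mazur_partial_sum_le:
  assumes "mazur_sequence e" "m \<le> n"
  shows "norm (\<Sum>i<m. a i *\<^sub>C e i) \<le> 2 * norm (\<Sum>i<n. a i *\<^sub>C e i)"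
proof -
  let ?S = "\<lambda>k. \<Sum>i<k. a i *\<^sub>C e i"
  have "growth m * norm (?S m) \<le> growth n * norm (?S n)"
    using assms(2)
  proof (induction rule: dec_induct)
    case (step k)
    have "?S k \<in> complex_vector.span (e ` {..<k})"
      by (intro complex_vector.span_sum complex_vector.span_scale complex_vector.span_base) auto
    then have "growth k * norm (?S k) \<le> growth (Suc k) * norm (?S k + a k *\<^sub>C e k)"
      using assms(1) unfolding mazur_sequence_def by blast
    then show ?case using step.IH by simp
  qed simp
  moreover have "norm (?S m) \<le> growth m * norm (?S m)"
    using mult_right_mono[OF growth_bounds(1)[of m], of "norm (?S m)"] by simp
  moreover have "growth n * norm (?S n) \<le> 2 * norm (?S n)"
    using growth_bounds(2) by (intro mult_right_mono) auto
  ultimately show ?thesis by linarith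
qed

lemma mazur_coefficient_le:
  assumes "mazur_sequence e" "i < n"
  shows "cmod (a i) \<le> 4 * norm (\<Sum>i<n. a i *\<^sub>C e i)"
proof -
  let ?S = "\<lambda>k. \<Sum>i<k. a i *\<^sub>C e i"
  have "cmod (a i) = norm (a i *\<^sub>C e i)"
    using assms(1) by (simp add: norm_scaleC mazur_sequence_def)
  also have "a i *\<^sub>C e i = ?S (Suc i) - ?S i" by simp
  also have "norm \<dots> \<le> norm (?S (Suc i)) + norm (?S i)" by (rule norm_triangle_ineq4)
  also have "\<dots> \<le> 4 * norm (?S n)"
    using mazur_partial_sum_le[OF assms(1), of "Suc i" n a] mazur_partial_sum_le[OF assms(1), of i n a] assms(2)
    by simp
  finally show ?thesis .
qed

lemma span_range_partial_sum:
  fixes e :: "nat \<Rightarrow> 'a::complex_banach"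
  assumes "y \<in> complex_vector.span (range e)"
  obtains a N where "\<And>n. N \<le> n \<Longrightarrow> (\<Sum>i<n. a i *\<^sub>C e i) = y"
proof -
  have "\<exists>a N. \<forall>n\<ge>N. (\<Sum>i<n. a i *\<^sub>C e i) = y"
    using assms
  proof (induction rule: complex_vector.span_induct_alt)
    case base
    show ?case by (rule exI[of _ "\<lambda>_. 0"]) simp
  next
    case (step c x y)
    then obtain a N k where a: "\<forall>n\<ge>N. (\<Sum>i<n. a i *\<^sub>C e i) = y" and x: "x = e k" by blast
    have "(\<Sum>i<n. (a i + (if i = k then c else 0)) *\<^sub>C e i) = c *\<^sub>C x + y" if "n \<ge> max N (Suc k)" for n
    proof -
      have "(\<Sum>i<n. (a i + (if i = k then c else 0)) *\<^sub>C e i)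
          = (\<Sum>i<n. a i *\<^sub>C e i) + (\<Sum>i<n. if i = k then c *\<^sub>C e k else 0)"
        unfolding sum.distrib[symmetric] by (rule sum.cong) (auto simp: scaleC_add_left)
      also have "(\<Sum>i<n. if i = k then c *\<^sub>C e k else 0) = c *\<^sub>C e k" using that by simp
      finally show ?thesis using a x that by simp
    qed
    then show ?case by (intro exI[of _ "\<lambda>i. a i + (if i = k then c else 0)"] exI[of _ "max N (Suc k)"]) blast
  qed
  then show ?thesis using that by blast
qed

text \<open>Along a sequence in the linear span that converges to \<open>y\<close>, every coefficient and every partial sum
  is Cauchy with a bound that does not depend on the index. This uniformity lets the limit of the
  partial sums be interchanged with the limit of the sequence.\<close>

lemma mazur_sequence_expansion:
  assumes e: "mazur_sequence e" and y: "y \<in> closed_cspan (range e)"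
  shows "\<exists>!a. (\<lambda>n. a n *\<^sub>C e n) sums y"
proof (rule ex_ex1I)
  obtain u where u: "\<And>k. u k \<in> complex_vector.span (range e)" "u \<longlonglongrightarrow> y"
    using y unfolding closed_cspan_def closure_sequential by blast
  have "\<exists>a N. \<forall>n\<ge>N. (\<Sum>i<n. a i *\<^sub>C e i) = u k" for k
    using span_range_partial_sum[OF u(1)[of k]] by metis
  then obtain a N where a: "\<And>k n. n \<ge> N k \<Longrightarrow> (\<Sum>i<n. a k i *\<^sub>C e i) = u k" by metis
  define S where "S b n = (\<Sum>i<n. b i *\<^sub>C e i)" for b :: "nat \<Rightarrow> complex" and n
  have S_diff: "S b n - S c n = S (\<lambda>i. b i - c i) n" for b c n
    by (simp add: S_def sum_subtractf complex_vector.scale_left_diff_distrib)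
  have proj: "norm (S (a k) n - S (a l) n) \<le> 2 * norm (u k - u l)" for k l n
  proof -
    let ?M = "max n (max (N k) (N l))"
    have "norm (S (\<lambda>i. a k i - a l i) n) \<le> 2 * norm (S (\<lambda>i. a k i - a l i) ?M)"
      unfolding S_def by (rule mazur_partial_sum_le[OF e]) simp
    moreover have "S (\<lambda>i. a k i - a l i) ?M = u k - u l"
      unfolding S_diff[symmetric] by (simp add: S_def a)
    ultimately show ?thesis by (simp add: S_diff)
  qed
  have coeff: "norm (a k i - a l i) \<le> 4 * norm (u k - u l)" for k l i
  proof -
    let ?M = "max (Suc i) (max (N k) (N l))"
    have "norm (a k i - a l i) \<le> 4 * norm (S (\<lambda>i. a k i - a l i) ?M)"
      unfolding S_def by (rule mazur_coefficient_le[OF e]) simp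
    moreover have "S (\<lambda>i. a k i - a l i) ?M = u k - u l"
      unfolding S_diff[symmetric] by (simp add: S_def a)
    ultimately show ?thesis by simp
  qed
  have "Cauchy u" using u(2) by (rule LIMSEQ_imp_Cauchy)
  have "Cauchy (\<lambda>k. a k i)" for i
  proof (rule metric_CauchyI)
    fix \<epsilon> :: real assume "\<epsilon> > 0"
    then obtain M where "\<forall>m\<ge>M. \<forall>n\<ge>M. dist (u m) (u n) < \<epsilon> / 4"
      using metric_CauchyD[OF \<open>Cauchy u\<close>, of "\<epsilon> / 4"] by auto
    then have "dist (a m i) (a n i) < \<epsilon>" if "m \<ge> M" "n \<ge> M" for m n
      using that coeff[of m i n] by (fastforce simp: dist_norm)
    then show "\<exists>M. \<forall>m\<ge>M. \<forall>n\<ge>M. dist (a m i) (a n i) < \<epsilon>" by blast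
  qed
  then have "\<exists>b. \<forall>i. (\<lambda>k. a k i) \<longlonglongrightarrow> b i"
    unfolding Cauchy_convergent_iff convergent_def by metis
  then obtain b where b: "\<And>i. (\<lambda>k. a k i) \<longlonglongrightarrow> b i" by blast
  have Sb: "(\<lambda>l. S (a l) n) \<longlonglongrightarrow> S b n" for n
    unfolding S_def by (intro tendsto_intros b)
  \<comment> \<open>The estimate is uniform in \<open>n\<close>; it is what interchanges the two limits.\<close>
  have close: "norm (S (a k) n - S b n) \<le> 2 * norm (u k - y)" for k n
  proof (rule LIMSEQ_le)
    show "(\<lambda>l. norm (S (a k) n - S (a l) n)) \<longlonglongrightarrow> norm (S (a k) n - S b n)"
      by (intro tendsto_intros Sb)
    show "(\<lambda>l. 2 * norm (u k - u l)) \<longlonglongrightarrow> 2 * norm (u k - y)"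
      by (intro tendsto_intros u)
  qed (use proj in blast)
  have "(\<lambda>n. S b n) \<longlonglongrightarrow> y"
  proof (rule metric_LIMSEQ_I)
    fix \<epsilon> :: real assume "\<epsilon> > 0"
    then obtain k where k: "norm (u k - y) < \<epsilon> / 3"
      using metric_LIMSEQ_D[OF u(2), of "\<epsilon> / 3"] by (auto simp: dist_norm)
    have "dist (S b n) y < \<epsilon>" if "n \<ge> N k" for n
    proof -
      have "S b n - y = (u k - y) - (S (a k) n - S b n)" using a[OF that] by (simp add: S_def)
      then have "norm (S b n - y) \<le> norm (u k - y) + norm (S (a k) n - S b n)"
        by (simp only: norm_triangle_ineq4)
      then show ?thesis using close[of k n] k by (simp add: dist_norm)
    qed
    then show "\<exists>M. \<forall>n\<ge>M. dist (S b n) y < \<epsilon>" by blast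
  qed
  then show "\<exists>a. (\<lambda>n. a n *\<^sub>C e n) sums y" unfolding sums_def S_def by blast
  fix c d assume cd: "(\<lambda>n. c n *\<^sub>C e n) sums y" "(\<lambda>n. d n *\<^sub>C e n) sums y"
  have lim: "(\<lambda>n. S (\<lambda>i. c i - d i) n) \<longlonglongrightarrow> 0"
    unfolding S_diff[symmetric] using tendsto_diff[OF cd[unfolded sums_def]] by (simp add: S_def)
  have "c i - d i = 0" for i
  proof -
    have "(\<lambda>n. 4 * norm (S (\<lambda>i. c i - d i) n)) \<longlonglongrightarrow> 4 * norm (0::'a)"
      by (intro tendsto_intros lim)
    then have "norm (c i - d i) \<le> 4 * norm (0::'a)"
      by (rule LIMSEQ_le_const)
        (auto simp: S_def intro!: exI[of _ "Suc i"] mazur_coefficient_le[OF e, of _ _ "\<lambda>i. c i - d i"])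
    then show ?thesis by simp
  qed
  then show "c = d" by auto
qed

text \<open>Basic sequences are indexed from \<open>1\<close>; the shift repeats the first vector at the index \<open>0\<close>.\<close>

lemma mazur_sequence_basic:
  assumes "mazur_sequence e"
  shows "basic_sequence (\<lambda>n. e (n - 1))"
proof -
  have "(\<lambda>n. e (n - 1)) ` {1..} = range e"
  proof (intro equalityI subsetI)
    show "y \<in> (\<lambda>n. e (n - 1)) ` {1..}" if "y \<in> range e" for y
      using that by (auto intro: image_eqI[of _ _ "Suc i" for i])
  qed auto
  then show ?thesis
    unfolding basic_sequence_def using mazur_sequence_expansion[OF assms] by simp
qed

lemma mazur_sequence_infinite_cdim:
  fixes e :: "nat \<Rightarrow> 'a::complex_banach"
  assumes "mazur_sequence e"
  shows "infinite_cdim (closed_cspan (range e))"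
proof -
  have new: "e n \<notin> complex_vector.span (e ` {..<n})" for n
  proof
    assume "e n \<in> complex_vector.span (e ` {..<n})"
    then have "growth n * norm (e n) \<le> growth (Suc n) * norm (e n + (- 1) *\<^sub>C e n)"
      using assms unfolding mazur_sequence_def by blast
    then show False
      using growth_bounds(1)[of n] assms by (simp add: mazur_sequence_def)
  qed
  have ind: "complex_vector.independent (e ` {..<n}) \<and> card (e ` {..<n}) = n" for n
  proof (induction n)
    case (Suc n)
    have eq: "e ` {..<Suc n} = insert (e n) (e ` {..<n})" by (simp add: lessThan_Suc)
    have "e n \<notin> e ` {..<n}"
      using new[of n] complex_vector.span_base[of "e n" "e ` {..<n}"] by metis
    moreover have "complex_vector.independent (insert (e n) (e ` {..<n}))"
      using complex_vector.independent_insertI[OF new[of n]] Suc.IH by metis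
    ultimately show ?case using Suc.IH unfolding eq by simp
  qed (simp add: complex_vector.independent_empty)
  show ?thesis
    unfolding infinite_cdim_def
  proof (intro notI, elim exE conjE)
    fix B assume B: "finite B" "complex_vector.span B = closed_cspan (range e)"
    have "e i \<in> complex_vector.span B" for i
    proof -
      have "e i \<in> complex_vector.span (range e)" by (simp add: complex_vector.span_base)
      then show ?thesis
        unfolding B closed_cspan_def by (rule subsetD[OF closure_subset])
    qed
    then have sub: "e ` {..<Suc (card B)} \<subseteq> complex_vector.span B" by (rule image_subsetI)
    have "card (e ` {..<Suc (card B)}) \<le> card B"
      by (rule conjunct2[OF complex_vector.independent_span_bound[OF B(1) conjunct1[OF ind] sub]])
    moreover have "card (e ` {..<Suc (card B)}) = Suc (card B)" by (rule conjunct2[OF ind])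
    ultimately show False by simp
  qed
qed

text \<open>If a seminorm \<open>q\<close> is not bounded below on any subspace of finite codimension of \<open>W\<close>, then Mazur's
  construction can choose the \<open>n\<close>-th vector with \<open>q\<close> below \<open>\<delta> 2\<^sup>-\<^sup>n / 8\<close>. Coefficients in a vector
  \<open>y\<close> are at most \<open>4 \<parallel>y\<parallel>\<close>, so summing the series bounds \<open>q\<close> by \<open>\<delta>\<close> on the whole span.\<close>

lemma mazur_sequence_small_seminorm:
  fixes W :: "'a::complex_banach set" and q :: "'a \<Rightarrow> real"
  assumes W: "complex_vector.subspace W"
    and q_add: "\<And>u v. u \<in> W \<Longrightarrow> v \<in> W \<Longrightarrow> q (u + v) \<le> q u + q v"
    and q_scale: "\<And>c u. u \<in> W \<Longrightarrow> q (c *\<^sub>C u) \<le> cmod c * q u"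
    and small: "\<And>\<Phi> \<delta>. finite \<Phi> \<Longrightarrow> \<forall>f\<in>\<Phi>. bounded_functional f \<Longrightarrow> \<delta> > 0 \<Longrightarrow>
      \<exists>w\<in>W \<inter> common_kernel \<Phi>. norm w = 1 \<and> q w < \<delta>"
    and "\<delta> > 0"
  obtains e where "mazur_sequence e" "range e \<subseteq> W"
    "\<And>y. y \<in> complex_vector.span (range e) \<Longrightarrow> q y \<le> \<delta> * norm y"
proof -
  define P where "P f n r \<longleftrightarrow> r \<in> W \<and> norm r = 1 \<and> q r < \<delta> / 8 * (1 / 2) ^ n \<and>
    (\<forall>c. \<forall>y\<in>complex_vector.span (f ` {..<n}). growth n * norm y \<le> growth (Suc n) * norm (y + c *\<^sub>C r))"
    for f :: "nat \<Rightarrow> 'a" and n r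
  have "\<exists>e. \<forall>n. P e n (e n)"
  proof (rule dependent_wellorder_choice)
    fix r :: 'a and f g :: "nat \<Rightarrow> 'a" and n assume "\<And>m. m < n \<Longrightarrow> f m = g m"
    then have "f ` {..<n} = g ` {..<n}" by auto
    then show "P f n r = P g n r" by (simp add: P_def)
  next
    fix n and f :: "nat \<Rightarrow> 'a"
    \<comment> \<open>Chosen such that \<open>1 - \<epsilon>\<close> is exactly the loss that the \<open>n\<close>-th step may cause.\<close>
    define \<epsilon> where "\<epsilon> = 1 - growth n / growth (Suc n)"
    have g: "0 < growth (Suc n)" using growth_bounds(1)[of "Suc n"] by simp
    then have "\<epsilon> > 0" using growth_bounds(3)[of n] by (simp add: \<epsilon>_def)
    obtain \<Phi> where \<Phi>: "finite \<Phi>" "\<forall>f\<in>\<Phi>. bounded_functional f"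
      "\<And>x y. y \<in> complex_vector.span (f ` {..<n}) \<Longrightarrow> x \<in> common_kernel \<Phi> \<Longrightarrow> (1 - \<epsilon>) * norm y \<le> norm (y + x)"
      using mazur_finite_codim[of "f ` {..<n}", OF _ \<open>\<epsilon> > 0\<close>] by blast
    have "\<delta> / 8 * (1 / 2) ^ n > 0" using \<open>\<delta> > 0\<close> by simp
    then obtain r where r: "r \<in> W" "r \<in> common_kernel \<Phi>" "norm r = 1" "q r < \<delta> / 8 * (1 / 2) ^ n"
      using small[OF \<Phi>(1,2)] by blast
    have "growth n * norm y \<le> growth (Suc n) * norm (y + c *\<^sub>C r)"
      if "y \<in> complex_vector.span (f ` {..<n})" for c y
    proof -
      have "c *\<^sub>C r \<in> common_kernel \<Phi>"
        using closed_csubspace_common_kernel[OF \<Phi>(2)] r(2)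
        by (simp add: closed_csubspace_def complex_vector.subspace_scale)
      then have "growth n / growth (Suc n) * norm y \<le> norm (y + c *\<^sub>C r)"
        using \<Phi>(3)[OF that] by (simp add: \<epsilon>_def)
      from mult_left_mono[OF this, of "growth (Suc n)"] g show ?thesis by simp
    qed
    then show "\<exists>r. P f n r" unfolding P_def using r by blast
  qed
  then obtain e where e: "\<And>n. P e n (e n)" by blast
  have ms: "mazur_sequence e" using e unfolding mazur_sequence_def P_def by blast
  have eW: "e n \<in> W" and qe: "q (e n) \<le> \<delta> / 8 * (1 / 2) ^ n" for n
    using e[of n] by (auto simp: P_def)
  have q0: "q 0 \<le> 0" using q_scale[of 0 0] complex_vector.subspace_0[OF W] by simp
  have "q y \<le> \<delta> * norm y" if y: "y \<in> complex_vector.span (range e)" for y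
  proof -
    obtain a N where "\<And>n. N \<le> n \<Longrightarrow> (\<Sum>i<n. a i *\<^sub>C e i) = y"
      using span_range_partial_sum[OF y] by blast
    then have aN: "(\<Sum>i<N. a i *\<^sub>C e i) = y" by simp
    have "q (\<Sum>i<n. a i *\<^sub>C e i) \<le> (\<Sum>i<n. cmod (a i) * q (e i))" for n
    proof (induction n)
      case (Suc n)
      have "(\<Sum>i<n. a i *\<^sub>C e i) \<in> W"
        by (intro complex_vector.subspace_sum complex_vector.subspace_scale W eW)
      then show ?case
        using q_add[of "\<Sum>i<n. a i *\<^sub>C e i" "a n *\<^sub>C e n"] q_scale[OF eW, of "a n" n] Suc
          complex_vector.subspace_scale[OF W eW, of "a n" n] by simp
    qed (simp add: q0)
    from this[of N] have "q y \<le> (\<Sum>i<N. cmod (a i) * q (e i))" by (simp add: aN)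
    also have "\<dots> \<le> (\<Sum>i<N. (4 * norm y) * (\<delta> / 8 * (1 / 2) ^ i))"
    proof (rule sum_mono)
      fix i assume "i \<in> {..<N}"
      then have "cmod (a i) \<le> 4 * norm y" using mazur_coefficient_le[OF ms, of i N a] aN by simp
      then show "cmod (a i) * q (e i) \<le> (4 * norm y) * (\<delta> / 8 * (1 / 2) ^ i)"
        using mult_left_mono[OF qe[of i] norm_ge_zero[of "a i"]] \<open>\<delta> > 0\<close>
        by (elim order_trans, intro mult_right_mono) auto
    qed
    also have "\<dots> = \<delta> / 2 * norm y * (\<Sum>i<N. (1 / 2) ^ i)"
      by (simp add: sum_distrib_left mult_ac)
    also have "\<dots> \<le> \<delta> / 2 * norm y * 2"
      using \<open>\<delta> > 0\<close> by (intro mult_left_mono) (simp_all add: sum_gp_strict)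
    finally show ?thesis by simp
  qed
  then show ?thesis using that ms eW by blast
qed

lemma infinite_cdim_unit_vector:
  assumes sub: "complex_vector.subspace W" and "infinite_cdim W"
  obtains w where "w \<in> W" "norm w = 1"
proof -
  have "W \<noteq> {0}"
    using assms(2) unfolding infinite_cdim_def
    by (metis complex_vector.span_empty empty_subsetI finite.emptyI)
  then obtain w where w: "w \<in> W" "w \<noteq> 0"
    using complex_vector.subspace_0[OF sub] by blast
  then have "norm (complex_of_real (1 / norm w) *\<^sub>C w) = 1"
    by (simp add: norm_scaleC norm_divide)
  then show ?thesis using that complex_vector.subspace_scale[OF sub w(1)] by blast
qed

lemma mazur_sequence_exists:
  fixes W :: "'a::complex_banach set"
  assumes "complex_vector.subspace W" "infinite_cdim W"
  obtains e where "mazur_sequence e" "range e \<subseteq> W"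
proof -
  have "\<exists>w\<in>W \<inter> common_kernel \<Phi>. norm w = 1 \<and> (0::real) < \<delta>"
    if "finite \<Phi>" "\<forall>f\<in>\<Phi>. bounded_functional f" "\<delta> > 0" for \<Phi> \<delta>
  proof -
    have sub: "complex_vector.subspace (W \<inter> common_kernel \<Phi>)"
      using closed_csubspace_common_kernel[OF that(2)] assms(1)
      by (simp add: closed_csubspace_def complex_vector.subspace_inter)
    then show ?thesis
      using infinite_cdim_unit_vector[OF sub infinite_cdim_Int_common_kernel[OF that(1,2) assms]] that(3)
      by blast
  qed
  then show ?thesis
    using mazur_sequence_small_seminorm[OF assms(1), of "\<lambda>_. 0" 1] that by auto
qed

section \<open>Operators that are bounded below\<close>

lemma bounded_clinear_on_diff:
  assumes "bounded_clinear_on Y S" "complex_vector.subspace Y" "x \<in> Y" "y \<in> Y"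
  shows "S (x - y) = S x - S y"
proof -
  have "S (x + (- 1) *\<^sub>C y) = S x + S ((- 1) *\<^sub>C y)"
    using assms complex_vector.subspace_scale[OF assms(2)] unfolding bounded_clinear_on_def by blast
  also have "S ((- 1) *\<^sub>C y) = (- 1) *\<^sub>C S y"
    using assms unfolding bounded_clinear_on_def by blast
  finally show ?thesis by simp
qed

lemma bounded_clinear_on_bound:
  assumes "bounded_clinear_on Y S"
  obtains K where "K \<ge> 0" "\<And>y. y \<in> Y \<Longrightarrow> norm (S y) \<le> K * norm y"
proof -
  obtain K where K: "\<And>y. y \<in> Y \<Longrightarrow> norm (S y) \<le> K * norm y"
    using assms unfolding bounded_clinear_on_def by blast
  have "norm (S y) \<le> max 0 K * norm y" if "y \<in> Y" for y
    using K[OF that] mult_right_mono[of K "max 0 K" "norm y"] by simp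
  then show ?thesis using that[of "max 0 K"] by simp
qed

lemma bounded_clinear_on_minus_scaleC:
  assumes "bounded_clinear_on Y T"
  shows "bounded_clinear_on Y (\<lambda>y. T y - c *\<^sub>C y)"
proof -
  obtain K where K: "K \<ge> 0" "\<And>y. y \<in> Y \<Longrightarrow> norm (T y) \<le> K * norm y"
    using bounded_clinear_on_bound[OF assms] by blast
  have "norm (T y - c *\<^sub>C y) \<le> (K + cmod c) * norm y" if "y \<in> Y" for y
    using norm_triangle_ineq4[of "T y" "c *\<^sub>C y"] K(2)[OF that] by (simp add: norm_scaleC distrib_right)
  moreover have "T (x + y) = T x + T y" "T (d *\<^sub>C x) = d *\<^sub>C T x" if "x \<in> Y" "y \<in> Y" for x y d
    using assms that unfolding bounded_clinear_on_def by blast+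
  ultimately show ?thesis
    unfolding bounded_clinear_on_def
    by (intro conjI ballI allI exI[of _ "K + cmod c"])
      (simp_all add: scaleC_add_right complex_vector.scale_right_diff_distrib complex_vector.scale_left_commute)
qed

lemma bounded_clinear_on_subset:
  assumes "bounded_clinear_on Y T" "V \<subseteq> Y"
  shows "bounded_clinear_on V T"
proof -
  obtain K where "\<forall>y\<in>Y. norm (T y) \<le> K * norm y"
    using assms(1) unfolding bounded_clinear_on_def by blast
  then have "\<forall>y\<in>V. norm (T y) \<le> K * norm y" using assms(2) by blast
  moreover have "T (x + y) = T x + T y" "T (c *\<^sub>C x) = c *\<^sub>C T x" if "x \<in> V" "y \<in> V" for x y c
    using assms that unfolding bounded_clinear_on_def by (meson subsetD)+
  ultimately show ?thesis unfolding bounded_clinear_on_def by blast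
qed

lemma subspace_image_clinear_on:
  assumes S: "bounded_clinear_on V S" and U: "complex_vector.subspace U" "U \<subseteq> V"
  shows "complex_vector.subspace (S ` U)"
proof (rule complex_vector.subspaceI)
  have scale: "S (c *\<^sub>C x) = c *\<^sub>C S x" if "x \<in> U" for c x
    using that U S unfolding bounded_clinear_on_def by blast
  have add: "S (x + y) = S x + S y" if "x \<in> U" "y \<in> U" for x y
    using that U S unfolding bounded_clinear_on_def by blast
  have "S 0 = 0" using scale[of 0 0] complex_vector.subspace_0[OF U(1)] by simp
  then show "0 \<in> S ` U" using complex_vector.subspace_0[OF U(1)] by (metis imageI)
  show "x + y \<in> S ` U" if "x \<in> S ` U" "y \<in> S ` U" for x y
    using that add complex_vector.subspace_add[OF U(1)] by (auto simp: image_iff) metis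
  show "c *\<^sub>C x \<in> S ` U" if "x \<in> S ` U" for c x
    using that scale complex_vector.subspace_scale[OF U(1)] by (auto simp: image_iff) metis
qed

text \<open>A finite spanning set of the image lifts to a finite subset of \<open>V\<close>, which spans \<open>V\<close> by
  injectivity.\<close>

lemma infinite_cdim_image_clinear_on:
  assumes S: "bounded_clinear_on V S" and V: "complex_vector.subspace V" "infinite_cdim V"
    and "c > 0" and lower: "\<And>y. y \<in> V \<Longrightarrow> c * norm y \<le> norm (S y)"
  shows "infinite_cdim (S ` V)"
  unfolding infinite_cdim_def
proof (intro notI, elim exE conjE)
  fix B assume "finite B" "B \<subseteq> S ` V" and span: "complex_vector.span B = S ` V"
  then obtain B' where B': "B' \<subseteq> V" "finite B'" "B = S ` B'" using finite_subset_image by metis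
  have sub: "complex_vector.span B' \<subseteq> V" using B'(1) V(1) by (rule complex_vector.span_minimal)
  have image: "complex_vector.span (S ` B') \<subseteq> S ` complex_vector.span B'"
    using subspace_image_clinear_on[OF S complex_vector.subspace_span sub]
    by (intro complex_vector.span_minimal image_mono complex_vector.span_superset)
  have "V \<subseteq> complex_vector.span B'"
  proof
    fix y assume "y \<in> V"
    then have "S y \<in> S ` complex_vector.span B'" using span image unfolding B'(3) by blast
    then obtain z where z: "z \<in> complex_vector.span B'" "S y = S z" by blast
    have "c * norm (y - z) \<le> norm (S (y - z))"
      using \<open>y \<in> V\<close> z sub V(1) by (intro lower complex_vector.subspace_diff) auto
    also have "S (y - z) = 0" using bounded_clinear_on_diff[OF S V(1) \<open>y \<in> V\<close>] z sub by auto
    finally have "y = z" using \<open>c > 0\<close> by (simp add: mult_le_0_iff)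
    then show "y \<in> complex_vector.span B'" using z by simp
  qed
  then show False using V(2) B' sub unfolding infinite_cdim_def by blast
qed

text \<open>Otherwise the seminorm \<open>y \<mapsto> \<parallel>S y\<parallel>\<close> is arbitrarily small on unit vectors of every subspace of
  finite codimension, and the closed span of a Mazur sequence adapted to it is a forbidden \<open>V\<close>.\<close>

lemma bounded_below_on_finite_codim:
  fixes S :: "'a::complex_banach \<Rightarrow> 'b::complex_banach"
  assumes S: "bounded_clinear_on Y S" and Y: "closed_csubspace Y" and "\<delta> > 0"
    and not_small: "\<nexists>V. closed_csubspace V \<and> infinite_cdim V \<and> V \<subseteq> Y \<and> (\<forall>v\<in>V. norm (S v) \<le> \<delta> * norm v)"
  shows "\<exists>\<Phi> c. finite \<Phi> \<and> (\<forall>f\<in>\<Phi>. bounded_functional f) \<and> c > 0 \<and>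
    (\<forall>y\<in>Y \<inter> common_kernel \<Phi>. c * norm y \<le> norm (S y))"
proof (rule ccontr)
  assume contr: "\<not> ?thesis"
  have sub: "complex_vector.subspace Y" and "closed Y" using Y by (simp_all add: closed_csubspace_def)
  obtain K where K: "K \<ge> 0" "\<And>y. y \<in> Y \<Longrightarrow> norm (S y) \<le> K * norm y"
    using bounded_clinear_on_bound[OF S] by blast
  have add: "S (x + y) = S x + S y" and scale: "S (c *\<^sub>C x) = c *\<^sub>C S x" if "x \<in> Y" "y \<in> Y" for x y c
    using that S unfolding bounded_clinear_on_def by blast+
  obtain e where e: "mazur_sequence e" "range e \<subseteq> Y"
    "\<And>y. y \<in> complex_vector.span (range e) \<Longrightarrow> norm (S y) \<le> \<delta> * norm y"
  proof (rule mazur_sequence_small_seminorm[OF sub _ _ _ \<open>\<delta> > 0\<close>, of "\<lambda>y. norm (S y)"])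
    show "norm (S (u + v)) \<le> norm (S u) + norm (S v)" if "u \<in> Y" "v \<in> Y" for u v
      using add[OF that] by (simp add: norm_triangle_ineq)
    show "norm (S (c *\<^sub>C u)) \<le> cmod c * norm (S u)" if "u \<in> Y" for c u
      using scale[OF that that] by (simp add: norm_scaleC)
    fix \<Phi> :: "('a \<Rightarrow> complex) set" and d :: real assume \<Phi>: "finite \<Phi>" "\<forall>f\<in>\<Phi>. bounded_functional f" "d > 0"
    then obtain y where y: "y \<in> Y \<inter> common_kernel \<Phi>" "norm (S y) < d * norm y"
      using contr by (meson not_le)
    then have "y \<noteq> 0" using K(2)[of y] by auto
    have "complex_vector.subspace (Y \<inter> common_kernel \<Phi>)"
      using closed_csubspace_Int[OF Y closed_csubspace_common_kernel[OF \<Phi>(2)]] by (simp add: closed_csubspace_def)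
    then have "of_real (1 / norm y) *\<^sub>C y \<in> Y \<inter> common_kernel \<Phi>"
      using y(1) by (rule complex_vector.subspace_scale)
    moreover have "norm (of_real (1 / norm y) *\<^sub>C y) = 1"
      using \<open>y \<noteq> 0\<close> by (simp add: norm_scaleC norm_divide)
    moreover have "norm (S (of_real (1 / norm y) *\<^sub>C y)) < d"
      using \<open>y \<noteq> 0\<close> y scale[of y y] by (simp add: norm_scaleC norm_divide field_simps)
    ultimately show "\<exists>w\<in>Y \<inter> common_kernel \<Phi>. norm w = 1 \<and> norm (S w) < d" by blast
  qed (rule that)
  define V where "V = closed_cspan (range e)"
  have VY: "V \<subseteq> Y" unfolding V_def by (rule closed_cspan_minimal[OF e(2) Y])
  have "norm (S v) \<le> \<delta> * norm v" if v: "v \<in> V" for v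
  proof -
    obtain u where u: "\<And>n. u n \<in> complex_vector.span (range e)" "u \<longlonglongrightarrow> v"
      using v unfolding V_def closed_cspan_def closure_sequential by blast
    have uY: "u n \<in> Y" for n
      using u(1) complex_vector.span_minimal[OF e(2) sub] by blast
    have lim0: "(\<lambda>n. K * norm (u n - v)) \<longlonglongrightarrow> K * norm (v - v)" by (intro tendsto_intros u)
    have S_close: "norm (S (u n) - S v) \<le> K * norm (u n - v)" for n
    proof -
      have "v \<in> Y" using v VY by blast
      then have "S (u n) - S v = S (u n - v)" "u n - v \<in> Y"
        using bounded_clinear_on_diff[OF S sub uY] complex_vector.subspace_diff[OF sub uY] by simp_all
      then show ?thesis using K(2)[of "u n - v"] by simp
    qed
    have "(\<lambda>n. S (u n) - S v) \<longlonglongrightarrow> 0"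
      by (rule Lim_null_comparison[OF always_eventually[OF allI[OF S_close]] lim0[simplified]])
    then have "(\<lambda>n. S (u n)) \<longlonglongrightarrow> S v" by (rule LIM_zero_cancel)
    then have lim: "(\<lambda>n. norm (S (u n))) \<longlonglongrightarrow> norm (S v)" by (rule tendsto_norm)
    show ?thesis
    proof (rule LIMSEQ_le[OF lim])
      show "(\<lambda>n. \<delta> * norm (u n)) \<longlonglongrightarrow> \<delta> * norm v" by (intro tendsto_intros u)
    qed (use e(3) u(1) in blast)
  qed
  moreover have "closed_csubspace V" "infinite_cdim V"
    unfolding V_def by (rule closed_csubspace_closed_cspan, rule mazur_sequence_infinite_cdim[OF e(1)])
  ultimately show False using not_small VY by blast
qed

section \<open>A discrete Cauchy theorem for approximate resolvents\<close>

text \<open>Here \<open>a\<close>, \<open>b\<close>, \<open>d\<close> are the approximate resolvent values at the corners \<open>p\<close>, \<open>p + h\<close>, \<open>p + \<i> h\<close> of a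
  grid cell, and \<open>h\<close> times the vector to be estimated is the contour sum around the cell that uses
  one corner value per edge. For exact values it is a multiple, of size \<open>h\<^sup>2\<close>, of the second divided
  difference. In the proof \<open>T - p\<close> is applied twice: it maps the vector to \<open>\<i> h (b - d)\<close>, and
  \<open>T - p - h\<close> maps \<open>b - d\<close> to \<open>(h - \<i> h) d\<close>, up to the approximation errors.\<close>

lemma resolvent_cell_estimate:
  fixes T :: "'a::complex_banach \<Rightarrow> 'a"
  assumes V: "complex_vector.subspace V"
    and T_add: "\<And>x y. x \<in> V \<Longrightarrow> y \<in> V \<Longrightarrow> T (x + y) = T x + T y"
    and T_scale: "\<And>c x. x \<in> V \<Longrightarrow> T (c *\<^sub>C x) = c *\<^sub>C T x"
    and "c > 0" and lower: "\<And>\<mu> y. y \<in> V \<Longrightarrow> c * norm y \<le> norm (T y - \<mu> *\<^sub>C y)"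
    and "norm v = 1" and h: "0 < h" "h \<le> 1" and \<delta>: "\<delta> \<le> h\<^sup>2"
    and abd: "a \<in> V" "b \<in> V" "d \<in> V"
    and a: "norm (T a - p *\<^sub>C a - v) \<le> \<delta>"
    and b: "norm (T b - (p + of_real h) *\<^sub>C b - v) \<le> \<delta>"
    and d: "norm (T d - (p + \<i> * of_real h) *\<^sub>C d - v) \<le> \<delta>"
  shows "norm (a - d + \<i> *\<^sub>C (b - a)) \<le> ((2 + 4 / c) / c + 4) / c * h\<^sup>2"
proof -
  define ea where "ea = T a - p *\<^sub>C a - v"
  define eb where "eb = T b - (p + of_real h) *\<^sub>C b - v"
  define ed where "ed = T d - (p + \<i> * of_real h) *\<^sub>C d - v"
  have Ta: "T a = v + ea + p *\<^sub>C a" and Tb: "T b = v + eb + (p + of_real h) *\<^sub>C b"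
    and Td: "T d = v + ed + (p + \<i> * of_real h) *\<^sub>C d"
    by (simp_all add: ea_def eb_def ed_def)
  have T_diff: "T (x - y) = T x - T y" if "x \<in> V" "y \<in> V" for x y
  proof -
    have "T (x - y) = T (x + (- 1) *\<^sub>C y)" by simp
    also have "\<dots> = T x + T ((- 1) *\<^sub>C y)"
      using that complex_vector.subspace_scale[OF V] by (intro T_add)
    also have "T ((- 1) *\<^sub>C y) = (- 1) *\<^sub>C T y" using that by (intro T_scale)
    finally show ?thesis by simp
  qed
  have h2: "h\<^sup>2 \<le> h" using h by (simp add: power2_eq_square mult_left_le)
  have "c * norm d \<le> norm (T d - (p + \<i> * of_real h) *\<^sub>C d)" by (rule lower) fact
  also have "\<dots> = norm (v + ed)" by (simp add: Td)
  also have "\<dots> \<le> 1 + \<delta>" using norm_triangle_ineq[of v ed] d \<open>norm v = 1\<close> by (simp add: ed_def)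
  also have "\<dots> \<le> 2" using \<delta> h h2 by linarith
  finally have nd: "norm d \<le> 2 / c" using \<open>c > 0\<close> by (simp add: field_simps)
  have bd: "b - d \<in> V" using abd V by (intro complex_vector.subspace_diff)
  have "c * norm (b - d) \<le> norm (T (b - d) - (p + of_real h) *\<^sub>C (b - d))" by (rule lower) fact
  also have "T (b - d) - (p + of_real h) *\<^sub>C (b - d) = eb - ed + (of_real h - \<i> * of_real h) *\<^sub>C d"
    using abd by (simp add: T_diff Tb Td scaleC_add_left complex_vector.scale_right_diff_distrib
        complex_vector.scale_left_diff_distrib)
  also have "norm \<dots> \<le> (norm eb + norm ed) + cmod (of_real h - \<i> * of_real h) * norm d"
    using norm_triangle_ineq[of "eb - ed" "(of_real h - \<i> * of_real h) *\<^sub>C d"] norm_triangle_ineq4[of eb ed]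
    by (simp add: norm_scaleC)
  also have "\<dots> \<le> (\<delta> + \<delta>) + (2 * h) * (2 / c)"
  proof (intro add_mono mult_mono)
    show "cmod (of_real h - \<i> * of_real h) \<le> 2 * h"
      using norm_triangle_ineq4[of "complex_of_real h" "\<i> * of_real h"] h by (simp add: norm_mult)
  qed (use b d nd h in \<open>simp_all add: eb_def ed_def\<close>)
  also have "\<dots> \<le> (2 + 4 / c) * h" using \<delta> h2 by (simp add: algebra_simps)
  finally have nbd: "norm (b - d) \<le> (2 + 4 / c) / c * h" using \<open>c > 0\<close> by (simp add: field_simps)
  let ?E = "a - d + \<i> *\<^sub>C (b - a)"
  have EV: "?E \<in> V" using abd V
    by (intro complex_vector.subspace_add complex_vector.subspace_scale complex_vector.subspace_diff)
  have "c * norm ?E \<le> norm (T ?E - p *\<^sub>C ?E)" by (rule lower) fact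
  also have "T ?E = T a - T d + \<i> *\<^sub>C (T b - T a)"
    using abd V by (simp add: T_add T_scale T_diff complex_vector.subspace_scale complex_vector.subspace_diff)
  also have "T a - T d + \<i> *\<^sub>C (T b - T a) - p *\<^sub>C ?E
      = (\<i> * of_real h) *\<^sub>C (b - d) + ((ea - ed) + \<i> *\<^sub>C (eb - ea))"
    by (simp add: Ta Tb Td scaleC_add_left scaleC_add_right complex_vector.scale_right_diff_distrib
        scaleC_scaleC algebra_simps)
  also have "norm \<dots> \<le> h * norm (b - d) + ((norm ea + norm ed) + (norm eb + norm ea))"
  proof -
    have "norm ((\<i> * of_real h) *\<^sub>C (b - d)) = h * norm (b - d)"
      using h by (simp add: norm_scaleC norm_mult)
    moreover have "norm (\<i> *\<^sub>C (eb - ea)) \<le> norm eb + norm ea"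
      by (simp add: norm_scaleC norm_triangle_ineq4)
    ultimately show ?thesis
      using norm_triangle_ineq[of "(\<i> * of_real h) *\<^sub>C (b - d)" "(ea - ed) + \<i> *\<^sub>C (eb - ea)"]
        norm_triangle_ineq[of "ea - ed" "\<i> *\<^sub>C (eb - ea)"] norm_triangle_ineq4[of ea ed] by linarith
  qed
  also have "\<dots> \<le> h * ((2 + 4 / c) / c * h) + ((h\<^sup>2 + h\<^sup>2) + (h\<^sup>2 + h\<^sup>2))"
    using a b d \<delta> h nbd by (intro add_mono mult_left_mono) (simp_all add: ea_def eb_def ed_def)
  also have "\<dots> = ((2 + 4 / c) / c + 4) * h\<^sup>2" by (simp add: algebra_simps power2_eq_square)
  finally show ?thesis using \<open>c > 0\<close> by (simp add: field_simps)
qed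

text \<open>Interior edges are traversed by two neighbouring cells in opposite directions, so only the
  boundary of the large square survives.\<close>

lemma cell_sums_telescope:
  fixes Y :: "nat \<Rightarrow> nat \<Rightarrow> 'a::complex_banach"
  shows "(\<Sum>i<M. \<Sum>j<M. Y i j - Y i (Suc j) + \<i> *\<^sub>C (Y (Suc i) j - Y i j))
       = (\<Sum>i<M. Y i 0 - Y i M) + \<i> *\<^sub>C (\<Sum>j<M. Y M j - Y 0 j)"
proof -
  have "(\<Sum>i<M. \<Sum>j<M. Y i j - Y i (Suc j) + \<i> *\<^sub>C (Y (Suc i) j - Y i j))
      = (\<Sum>i<M. \<Sum>j<M. Y i j - Y i (Suc j)) + (\<Sum>i<M. \<Sum>j<M. \<i> *\<^sub>C (Y (Suc i) j - Y i j))"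
    by (simp only: sum.distrib)
  also have "(\<Sum>i<M. \<Sum>j<M. Y i j - Y i (Suc j)) = (\<Sum>i<M. Y i 0 - Y i M)"
    by (simp only: sum_lessThan_telescope')
  also have "(\<Sum>i<M. \<Sum>j<M. \<i> *\<^sub>C (Y (Suc i) j - Y i j)) = (\<Sum>j<M. \<Sum>i<M. \<i> *\<^sub>C (Y (Suc i) j - Y i j))"
    by (rule sum.swap)
  also have "\<dots> = \<i> *\<^sub>C (\<Sum>j<M. \<Sum>i<M. Y (Suc i) j - Y i j)"
    by (simp only: complex_vector.scale_sum_right)
  also have "(\<Sum>j<M. \<Sum>i<M. Y (Suc i) j - Y i j) = (\<Sum>j<M. Y M j - Y 0 j)"
    by (intro sum.cong refl sum_lessThan_telescope)
  finally show ?thesis .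
qed

text \<open>The contour sum of \<open>1 / z\<close> around the square with corners \<open>\<plusminus>R \<plusminus> \<i> R\<close>, with the factor \<open>h\<close> left
  out. Values at opposite boundary points combine to \<open>2 R / (x\<^sup>2 + R\<^sup>2)\<close> times \<open>\<i>\<close> or \<open>1\<close>, which avoids
  evaluating the integral \<open>2 \<pi> \<i>\<close>.\<close>

lemma boundary_sum_of_inverse:
  fixes R h :: real
  assumes "R > 0" "h * real M = 2 * R" "h > 0"
  defines "p \<equiv> \<lambda>i j. Complex (- R + h * real i) (- R + h * real j)"
  shows "2 * real M / R
    \<le> cmod ((\<Sum>i<M. 1 / p i 0 - 1 / p i M) + \<i> * (\<Sum>j<M. 1 / p M j - 1 / p 0 j))"
proof -
  have edge: "1 / R \<le> 2 * R / (x\<^sup>2 + R\<^sup>2)" if "\<bar>x\<bar> \<le> R" for x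
  proof -
    have "x\<^sup>2 \<le> R\<^sup>2" using power_mono[OF that, of 2] by simp
    then have "2 * R / (R\<^sup>2 + R\<^sup>2) \<le> 2 * R / (x\<^sup>2 + R\<^sup>2)"
      using \<open>R > 0\<close> by (intro divide_left_mono mult_pos_pos add_nonneg_pos) auto
    then show ?thesis using \<open>R > 0\<close> by (simp add: power2_eq_square)
  qed
  have side: "\<bar>- R + h * real i\<bar> \<le> R" if "i < M" for i
  proof -
    have "h * real i \<le> h * real M" using that assms(3) by (intro mult_left_mono) auto
    moreover have "0 \<le> h * real i" using assms(3) by simp
    ultimately show ?thesis using assms(2) by (simp add: abs_le_iff)
  qed
  have horizontal: "1 / R \<le> Im (1 / p i 0 - 1 / p i M)" if "i < M" for i
  proof -
    have "Im (1 / p i 0 - 1 / p i M) = 2 * R / ((- R + h * real i)\<^sup>2 + R\<^sup>2)"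
      using assms(2) by (simp add: p_def Im_divide add_divide_distrib[symmetric])
    then show ?thesis using edge[OF side[OF that]] by simp
  qed
  have vertical: "1 / R \<le> Re (1 / p M j - 1 / p 0 j)" if "j < M" for j
  proof -
    have "Re (1 / p M j - 1 / p 0 j) = 2 * R / ((- R + h * real j)\<^sup>2 + R\<^sup>2)"
      using assms(2) by (simp add: p_def Re_divide add_divide_distrib[symmetric] add.commute)
    then show ?thesis using edge[OF side[OF that]] by simp
  qed
  have "2 * real M / R = (\<Sum>i<M. 1 / R) + (\<Sum>j<M. 1 / R)" by simp
  also have "\<dots> \<le> (\<Sum>i<M. Im (1 / p i 0 - 1 / p i M)) + (\<Sum>j<M. Re (1 / p M j - 1 / p 0 j))"
    using horizontal vertical by (intro add_mono sum_mono) auto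
  also have "\<dots> = Im ((\<Sum>i<M. 1 / p i 0 - 1 / p i M) + \<i> * (\<Sum>j<M. 1 / p M j - 1 / p 0 j))"
    by simp
  also have "\<dots> \<le> cmod ((\<Sum>i<M. 1 / p i 0 - 1 / p i M) + \<i> * (\<Sum>j<M. 1 / p M j - 1 / p 0 j))"
    by (rule order_trans[OF abs_ge_self abs_Im_le_cmod])
  finally show ?thesis .
qed

text \<open>From \<open>\<mu> y = T y - v - e\<close> with a small error \<open>e\<close>: first \<open>\<parallel>y\<parallel> \<le> 4 / R\<close>, and then
  \<open>y + v / \<mu> = (T y - e) / \<mu>\<close> is of order \<open>1 / R\<^sup>2\<close>, up to the error.\<close>

lemma resolvent_far_estimate:
  fixes T :: "'a::complex_banach \<Rightarrow> 'a"
  assumes K: "norm (T y) \<le> K * norm y" "K \<ge> 0" and "norm v = 1"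
    and R: "R > 0" "2 * K \<le> R" "R \<le> cmod \<mu>" and \<delta>: "0 \<le> \<delta>" "\<delta> \<le> 1"
    and y: "norm (T y - \<mu> *\<^sub>C y - v) \<le> \<delta>"
  shows "norm (y + (1 / \<mu>) *\<^sub>C v) \<le> (4 * K / R + \<delta>) / R"
proof -
  define e where "e = T y - \<mu> *\<^sub>C y - v"
  have Ly: "\<mu> *\<^sub>C y = T y - (v + e)" by (simp add: e_def)
  have ne: "norm e \<le> \<delta>" using y by (simp add: e_def)
  have "R * norm y \<le> norm (\<mu> *\<^sub>C y)" using R by (simp add: norm_scaleC mult_right_mono)
  also have "\<dots> \<le> norm (T y) + (norm v + norm e)"
    unfolding Ly using norm_triangle_ineq4[of "T y" "v + e"] norm_triangle_ineq[of v e] by linarith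
  also have "\<dots> \<le> K * norm y + 2" using K(1) ne \<delta> \<open>norm v = 1\<close> by linarith
  also have "K * norm y \<le> R / 2 * norm y" using R by (intro mult_right_mono) auto
  finally have "R * norm y \<le> 4" by (simp add: algebra_simps)
  then have ny: "norm y \<le> 4 / R" using R by (simp add: field_simps)
  have "\<mu> \<noteq> 0" using R by auto
  then have "y + (1 / \<mu>) *\<^sub>C v = (1 / \<mu>) *\<^sub>C (\<mu> *\<^sub>C y + v)"
    by (simp add: scaleC_add_right scaleC_scaleC)
  also have "\<mu> *\<^sub>C y + v = T y - e" by (simp add: Ly)
  finally have "norm (y + (1 / \<mu>) *\<^sub>C v) = norm (T y - e) / cmod \<mu>"
    by (simp add: norm_scaleC norm_divide)
  also have "\<dots> \<le> (4 * K / R + \<delta>) / R"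
  proof (rule frac_le)
    have "norm (T y - e) \<le> norm (T y) + norm e" by (rule norm_triangle_ineq4)
    also have "\<dots> \<le> K * (4 / R) + \<delta>"
      using K ne ny by (intro add_mono order_trans[OF K(1)] mult_left_mono)
    finally show "norm (T y - e) \<le> 4 * K / R + \<delta>" by (simp add: mult.commute)
  qed (use R K(2) \<delta> in auto)
  finally show ?thesis .
qed

text \<open>Discrete form of the proof that the spectrum is nonempty. The order of choices matters: the size
  \<open>R\<close> of the square depends on the bound \<open>K\<close>, the number \<open>M\<close> of cells per side on \<open>R\<close> and \<open>c\<close>, and
  the tolerance \<open>\<delta>\<close> on the mesh \<open>h\<close>.\<close>

lemma no_bounded_approximate_resolvent:
  fixes T :: "'a::complex_banach \<Rightarrow> 'a"
  assumes V: "complex_vector.subspace V"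
    and T_add: "\<And>x y. x \<in> V \<Longrightarrow> y \<in> V \<Longrightarrow> T (x + y) = T x + T y"
    and T_scale: "\<And>c x. x \<in> V \<Longrightarrow> T (c *\<^sub>C x) = c *\<^sub>C T x"
    and K: "\<And>x. x \<in> V \<Longrightarrow> norm (T x) \<le> K * norm x" "K \<ge> 0"
    and "c > 0" and lower: "\<And>\<mu> y. y \<in> V \<Longrightarrow> c * norm y \<le> norm (T y - \<mu> *\<^sub>C y)"
  shows "\<exists>\<Lambda> \<delta>. finite \<Lambda> \<and> \<delta> > 0 \<and>
    \<not> (\<exists>v. norm v = 1 \<and> (\<forall>\<mu>\<in>\<Lambda>. \<exists>y\<in>V. norm (T y - \<mu> *\<^sub>C y - v) \<le> \<delta>))"
proof -
  \<comment> \<open>Together with \<open>\<delta> \<le> 1 / 8\<close>, makes the boundary values of \<open>y\<close> differ from \<open>- v / \<mu>\<close> by at most \<open>1 / (4 R)\<close>.\<close>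
  define R where "R = 32 * K + 1"
  define C where "C = ((2 + 4 / c) / c + 4) / c"
  have R: "R > 0" "2 * K \<le> R" "4 * K / R \<le> 1 / 8" using K(2) by (simp_all add: R_def field_simps)
  have "C > 0" using \<open>c > 0\<close> by (simp add: C_def add_pos_pos)
  \<comment> \<open>The interior contributes at most \<open>M\<^sup>2 C h\<^sup>2 = 4 R\<^sup>2 C\<close>, the boundary at least \<open>M / R\<close>.\<close>
  obtain M :: nat where M: "4 * R ^ 3 * C + 2 * R < real M" using reals_Archimedean2 by blast
  have "0 < 4 * R ^ 3 * C" using R \<open>C > 0\<close> by simp
  then have Mpos: "real M > 0" "2 * R < real M" "4 * R ^ 3 * C < real M" using M R by linarith+
  define h where "h = 2 * R / real M"
  have h: "0 < h" "h \<le> 1" "h * real M = 2 * R" using Mpos R by (simp_all add: h_def)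
  define \<delta> where "\<delta> = min (h\<^sup>2) (1 / 8)"
  have \<delta>: "\<delta> > 0" "\<delta> \<le> h\<^sup>2" "\<delta> \<le> 1 / 8" using h by (simp_all add: \<delta>_def)
  define p where "p i j = Complex (- R + h * real i) (- R + h * real j)" for i j
  have p_right: "p (Suc i) j = p i j + of_real h" and p_up: "p i (Suc j) = p i j + \<i> * of_real h" for i j
    by (simp_all add: p_def complex_eq_iff algebra_simps)
  define \<Lambda> where "\<Lambda> = (\<lambda>(i, j). p i j) ` ({..M} \<times> {..M})"
  have "\<not> (\<exists>v. norm v = 1 \<and> (\<forall>\<mu>\<in>\<Lambda>. \<exists>y\<in>V. norm (T y - \<mu> *\<^sub>C y - v) \<le> \<delta>))"
  proof (intro notI, elim exE conjE)
    fix v assume v: "norm v = 1" "\<forall>\<mu>\<in>\<Lambda>. \<exists>y\<in>V. norm (T y - \<mu> *\<^sub>C y - v) \<le> \<delta>"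
    then obtain f where f: "\<And>\<mu>. \<mu> \<in> \<Lambda> \<Longrightarrow> f \<mu> \<in> V \<and> norm (T (f \<mu>) - \<mu> *\<^sub>C f \<mu> - v) \<le> \<delta>" by metis
    define Y where "Y i j = f (p i j)" for i j
    have YV: "Y i j \<in> V" and Y: "norm (T (Y i j) - p i j *\<^sub>C Y i j - v) \<le> \<delta>" if "i \<le> M" "j \<le> M" for i j
      using f[of "p i j"] that by (auto simp: \<Lambda>_def Y_def)
    let ?B = "(\<Sum>i<M. Y i 0 - Y i M) + \<i> *\<^sub>C (\<Sum>j<M. Y M j - Y 0 j)"
    let ?\<beta> = "(\<Sum>i<M. 1 / p i 0 - 1 / p i M) + \<i> * (\<Sum>j<M. 1 / p M j - 1 / p 0 j)"
    have cell: "norm (Y i j - Y i (Suc j) + \<i> *\<^sub>C (Y (Suc i) j - Y i j)) \<le> C * h\<^sup>2"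
      if "i < M" "j < M" for i j
      unfolding C_def
    proof (rule resolvent_cell_estimate[OF V T_add T_scale \<open>c > 0\<close> lower v(1) h(1,2) \<delta>(2)])
      show "norm (T (Y i j) - p i j *\<^sub>C Y i j - v) \<le> \<delta>" using Y[of i j] that by simp
      show "norm (T (Y (Suc i) j) - (p i j + of_real h) *\<^sub>C Y (Suc i) j - v) \<le> \<delta>"
        using Y[of "Suc i" j] that by (simp add: p_right)
      show "norm (T (Y i (Suc j)) - (p i j + \<i> * of_real h) *\<^sub>C Y i (Suc j) - v) \<le> \<delta>"
        using Y[of i "Suc j"] that by (simp add: p_up)
    qed (use that YV in auto)
    have "norm ?B \<le> (\<Sum>i<M. \<Sum>j<M. C * h\<^sup>2)"
      unfolding cell_sums_telescope[symmetric]
      by (intro sum_norm_le cell) auto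
    also have "\<dots> = C * (h * real M)\<^sup>2" by (simp add: power2_eq_square)
    finally have B_small: "norm ?B \<le> 4 * R\<^sup>2 * C" by (simp add: h(3) power2_eq_square mult_ac)
    have far: "norm (Y i j + (1 / p i j) *\<^sub>C v) \<le> 1 / (4 * R)"
      if "i \<le> M" "j \<le> M" "i = 0 \<or> i = M \<or> j = 0 \<or> j = M" for i j
    proof -
      have "R \<le> cmod (p i j)"
        using that(3) abs_Re_le_cmod[of "p i j"] abs_Im_le_cmod[of "p i j"] R(1) h(3)
        by (auto simp: p_def)
      then have "norm (Y i j + (1 / p i j) *\<^sub>C v) \<le> (4 * K / R + \<delta>) / R"
        using \<delta> R Y YV K v(1) that by (intro resolvent_far_estimate[of T]) auto
      also have "4 * K / R + \<delta> \<le> 1 / 4" using R(3) \<delta>(3) by linarith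
      then have "(4 * K / R + \<delta>) / R \<le> (1 / 4) / R" using R(1) by (intro divide_right_mono) auto
      finally show ?thesis by simp
    qed
    have "?B + ?\<beta> *\<^sub>C v = (\<Sum>i<M. (Y i 0 + (1 / p i 0) *\<^sub>C v) - (Y i M + (1 / p i M) *\<^sub>C v))
        + \<i> *\<^sub>C (\<Sum>j<M. (Y M j + (1 / p M j) *\<^sub>C v) - (Y 0 j + (1 / p 0 j) *\<^sub>C v))"
      by (simp add: sum.distrib sum_subtractf scaleC_add_left scaleC_add_right scaleC_scaleC[symmetric]
          complex_vector.scale_sum_left complex_vector.scale_left_diff_distrib
          complex_vector.scale_right_diff_distrib algebra_simps)
    also have "norm \<dots> \<le> (\<Sum>i<M. 1 / (4 * R) + 1 / (4 * R)) + (\<Sum>j<M. 1 / (4 * R) + 1 / (4 * R))"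
    proof (rule norm_triangle_le, rule add_mono)
      show "norm (\<Sum>i<M. (Y i 0 + (1 / p i 0) *\<^sub>C v) - (Y i M + (1 / p i M) *\<^sub>C v))
          \<le> (\<Sum>i<M. 1 / (4 * R) + 1 / (4 * R))"
        by (intro sum_norm_le order_trans[OF norm_triangle_ineq4] add_mono far) auto
      have "norm (\<Sum>j<M. (Y M j + (1 / p M j) *\<^sub>C v) - (Y 0 j + (1 / p 0 j) *\<^sub>C v))
          \<le> (\<Sum>j<M. 1 / (4 * R) + 1 / (4 * R))"
        by (intro sum_norm_le order_trans[OF norm_triangle_ineq4] add_mono far) auto
      then show "norm (\<i> *\<^sub>C (\<Sum>j<M. (Y M j + (1 / p M j) *\<^sub>C v) - (Y 0 j + (1 / p 0 j) *\<^sub>C v)))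
          \<le> (\<Sum>j<M. 1 / (4 * R) + 1 / (4 * R))"
        by (simp only: norm_scaleC) simp
    qed
    also have "\<dots> = real M / R" by simp
    finally have "norm (?B + ?\<beta> *\<^sub>C v) \<le> real M / R" .
    moreover have "2 * real M / R \<le> norm (?\<beta> *\<^sub>C v)"
      using boundary_sum_of_inverse[OF R(1) h(3,1)] v(1) unfolding norm_scaleC p_def by simp
    moreover have "norm (?\<beta> *\<^sub>C v) \<le> norm (?B + ?\<beta> *\<^sub>C v) + norm ?B"
      using norm_triangle_ineq4[of "?B + ?\<beta> *\<^sub>C v" ?B] by simp
    ultimately have "2 * real M / R \<le> real M / R + 4 * R\<^sup>2 * C" using B_small by linarith
    moreover have "2 * real M / R = real M / R + real M / R" by simp
    ultimately have "real M / R \<le> 4 * R\<^sup>2 * C" by linarith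
    then have "real M \<le> 4 * R\<^sup>2 * C * R" using R(1) by (simp add: pos_divide_le_eq)
    then show False using Mpos(3) by (simp add: power2_eq_square power3_eq_cube mult_ac)
  qed
  moreover have "finite \<Lambda>" by (simp add: \<Lambda>_def)
  ultimately show ?thesis using \<delta>(1) by blast
qed

section \<open>Neighbouring subspaces of a hereditarily indecomposable space\<close>

lemma infdist_less_obtain:
  fixes u :: "'a::real_normed_vector"
  assumes "infdist u W < r" "W \<noteq> {}"
  obtains a where "a \<in> W" "norm (u - a) < r"
proof -
  have "\<exists>a\<in>W. norm (u - a) < r"
  proof (rule ccontr)
    assume "\<not> ?thesis"
    then have "r \<le> infdist u W"
      unfolding infdist_notempty[OF assms(2)] using assms(2)
      by (intro cINF_greatest) (auto simp: dist_norm not_less)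
    then show False using assms(1) by simp
  qed
  then show ?thesis using that by blast
qed

lemma infdist_subspace_add:
  fixes W :: "'a::complex_banach set"
  assumes W: "complex_vector.subspace W"
  shows "infdist (u + v) W \<le> infdist u W + infdist v W"
proof (rule field_le_epsilon)
  fix \<epsilon> :: real assume "\<epsilon> > 0"
  have ne: "W \<noteq> {}" using complex_vector.subspace_0[OF W] by blast
  obtain a where a: "a \<in> W" "norm (u - a) < infdist u W + \<epsilon> / 2"
    using infdist_less_obtain[of u W, OF _ ne] \<open>\<epsilon> > 0\<close> by (metis less_add_same_cancel1 half_gt_zero)
  obtain b where b: "b \<in> W" "norm (v - b) < infdist v W + \<epsilon> / 2"
    using infdist_less_obtain[of v W, OF _ ne] \<open>\<epsilon> > 0\<close> by (metis less_add_same_cancel1 half_gt_zero)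
  have "infdist (u + v) W \<le> norm ((u + v) - (a + b))"
    unfolding dist_norm[symmetric] by (intro infdist_le complex_vector.subspace_add[OF W] a b)
  also have "\<dots> = norm ((u - a) + (v - b))" by (simp add: algebra_simps)
  also have "\<dots> \<le> norm (u - a) + norm (v - b)" by (rule norm_triangle_ineq)
  finally show "infdist (u + v) W \<le> infdist u W + infdist v W + \<epsilon>" using a b by simp
qed

lemma infdist_subspace_scaleC:
  fixes W :: "'a::complex_banach set"
  assumes W: "complex_vector.subspace W"
  shows "infdist (c *\<^sub>C u) W \<le> cmod c * infdist u W"
proof (cases "c = 0")
  case True
  then show ?thesis using complex_vector.subspace_0[OF W] by simp
next
  case False
  have ne: "W \<noteq> {}" using complex_vector.subspace_0[OF W] by blast
  have "infdist (c *\<^sub>C u) W / cmod c \<le> infdist u W"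
    unfolding infdist_notempty[OF ne, of u]
  proof (rule cINF_greatest[OF ne])
    fix a assume "a \<in> W"
    then have "infdist (c *\<^sub>C u) W \<le> norm (c *\<^sub>C u - c *\<^sub>C a)"
      unfolding dist_norm[symmetric] by (intro infdist_le complex_vector.subspace_scale[OF W])
    also have "\<dots> = cmod c * dist u a"
      by (simp add: complex_vector.scale_right_diff_distrib[symmetric] norm_scaleC dist_norm)
    finally show "infdist (c *\<^sub>C u) W / cmod c \<le> dist u a" using False by (simp add: field_simps)
  qed
  then show ?thesis using False by (simp add: field_simps)
qed

text \<open>The distance to \<open>W\<close> is a seminorm. On every subspace of finite codimension of \<open>V\<close> it is arbitrarily
  small on unit vectors, by hereditary indecomposability applied to that subspace and to a basic
  sequence in \<open>W\<close>. So a Mazur sequence in \<open>V\<close> can be adapted to it.\<close>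

lemma hereditarily_indecomposable_nearby:
  fixes V W :: "'a::complex_banach set"
  assumes HI: "hereditarily_indecomposable \<F> TYPE('a)"
    and V: "closed_csubspace V" "infinite_cdim V"
    and W: "complex_vector.subspace W" "infinite_cdim W" and "\<delta> > 0"
  obtains V' where "closed_csubspace V'" "infinite_cdim V'" "V' \<subseteq> V" "\<And>v. v \<in> V' \<Longrightarrow> infdist v W \<le> \<delta> * norm v"
proof -
  obtain x where x: "mazur_sequence x" "range x \<subseteq> W" using mazur_sequence_exists[OF W] by blast
  define x' where "x' n = x (n - 1)" for n
  have basic: "basic_sequence x'" unfolding x'_def by (rule mazur_sequence_basic[OF x(1)])
  have ne: "W \<noteq> {}" using complex_vector.subspace_0[OF W(1)] by blast
  have sub: "complex_vector.subspace V" using V by (simp add: closed_csubspace_def)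
  obtain e where e: "mazur_sequence e" "range e \<subseteq> V"
    "\<And>y. y \<in> complex_vector.span (range e) \<Longrightarrow> infdist y W \<le> \<delta> * norm y"
  proof (rule mazur_sequence_small_seminorm[OF sub _ _ _ \<open>\<delta> > 0\<close>, of "\<lambda>y. infdist y W"])
    show "infdist (u + v) W \<le> infdist u W + infdist v W" for u v by (rule infdist_subspace_add[OF W(1)])
    show "infdist (c *\<^sub>C u) W \<le> cmod c * infdist u W" for c u by (rule infdist_subspace_scaleC[OF W(1)])
    fix \<Phi> :: "('a \<Rightarrow> complex) set" and d :: real assume \<Phi>: "finite \<Phi>" "\<forall>f\<in>\<Phi>. bounded_functional f" "d > 0"
    have "closed_csubspace (V \<inter> common_kernel \<Phi>)"
      by (intro closed_csubspace_Int V closed_csubspace_common_kernel \<Phi>)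
    moreover have "infinite_cdim (V \<inter> common_kernel \<Phi>)"
      by (rule infinite_cdim_Int_common_kernel[OF \<Phi>(1,2) sub V(2)])
    ultimately obtain F z where z: "z \<in> V \<inter> common_kernel \<Phi>" "norm z = 1" "infdist z (closed_cspan (x' ` F)) < d"
      using HI basic \<Phi>(3) unfolding hereditarily_indecomposable_def by blast
    have "closed_cspan (x' ` F) \<subseteq> closure W"
      using x(2) W(1) unfolding closed_cspan_def x'_def
      by (intro closure_mono complex_vector.span_minimal) auto
    moreover have "closed_cspan (x' ` F) \<noteq> {}"
      unfolding closed_cspan_def using complex_vector.span_zero by auto
    ultimately have "infdist z (closure W) \<le> infdist z (closed_cspan (x' ` F))" by (rule infdist_mono)
    moreover have "infdist z (closure W) = infdist z W" by (simp add: infdist_eq_setdist)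
    ultimately show "\<exists>w\<in>V \<inter> common_kernel \<Phi>. norm w = 1 \<and> infdist w W < d" using z by force
  qed (rule that)
  define V' where "V' = closed_cspan (range e)"
  have "infdist v W \<le> \<delta> * norm v" if v: "v \<in> V'" for v
  proof -
    obtain u where u: "\<And>n. u n \<in> complex_vector.span (range e)" "u \<longlonglongrightarrow> v"
      using v unfolding V'_def closed_cspan_def closure_sequential by blast
    show ?thesis
    proof (rule LIMSEQ_le)
      show "(\<lambda>n. infdist (u n) W) \<longlonglongrightarrow> infdist v W" by (intro tendsto_intros u)
      show "(\<lambda>n. \<delta> * norm (u n)) \<longlonglongrightarrow> \<delta> * norm v" by (intro tendsto_intros u)
    qed (use e(3) u(1) in blast)
  qed
  moreover have "V' \<subseteq> V" unfolding V'_def by (rule closed_cspan_minimal[OF e(2) V(1)])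
  ultimately show ?thesis
    using that[of V'] mazur_sequence_infinite_cdim[OF e(1)] closed_csubspace_closed_cspan[of "range e"]
    unfolding V'_def by blast
qed

text \<open>Passing to a smaller subspace preserves closeness to the subspaces treated before.\<close>

lemma hereditarily_indecomposable_common_nearby:
  fixes W :: "'i \<Rightarrow> 'a::complex_banach set"
  assumes HI: "hereditarily_indecomposable \<F> TYPE('a)" and V: "closed_csubspace V" "infinite_cdim V"
    and "finite I" and W: "\<And>i. i \<in> I \<Longrightarrow> complex_vector.subspace (W i)" "\<And>i. i \<in> I \<Longrightarrow> infinite_cdim (W i)"
    and "\<delta> > 0"
  shows "\<exists>V'. closed_csubspace V' \<and> infinite_cdim V' \<and> V' \<subseteq> V \<and> (\<forall>i\<in>I. \<forall>v\<in>V'. infdist v (W i) \<le> \<delta> * norm v)"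
  using \<open>finite I\<close> W
proof (induction I rule: finite_induct)
  case empty
  then show ?case using V by blast
next
  case (insert i I)
  then obtain V' where V': "closed_csubspace V'" "infinite_cdim V'" "V' \<subseteq> V"
    "\<forall>i\<in>I. \<forall>v\<in>V'. infdist v (W i) \<le> \<delta> * norm v"
    by (metis insertI2)
  obtain V'' where "closed_csubspace V''" "infinite_cdim V''" "V'' \<subseteq> V'"
    "\<And>v. v \<in> V'' \<Longrightarrow> infdist v (W i) \<le> \<delta> * norm v"
    using hereditarily_indecomposable_nearby[OF HI V'(1,2) _ _ \<open>\<delta> > 0\<close>, of "W i"] insert.prems by blast
  then show ?case using V' by (intro exI[of _ V'']) blast
qed

section \<open>Scalar plus strictly singular\<close>

text \<open>If every scalar fails, a compactness argument gives a subspace \<open>V\<close> of finite codimension in \<open>Y\<close> on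
  which all \<open>T - \<mu>\<close> are bounded below by the same constant \<open>m\<close>. Then the images \<open>(T - \<mu>) V\<close> are
  infinite-dimensional, and common near vectors of them are approximate resolvent values of the kind
  excluded by \<open>no_bounded_approximate_resolvent\<close>.\<close>

lemma hereditarily_indecomposable_approximate_eigenvalue:
  fixes T :: "'a::complex_banach \<Rightarrow> 'a"
  assumes HI: "hereditarily_indecomposable \<F> TYPE('a)"
    and Y: "closed_csubspace Y" "infinite_cdim Y" and T: "bounded_clinear_on Y T"
  shows "\<exists>\<mu>. \<forall>\<epsilon>>0. \<exists>V. closed_csubspace V \<and> infinite_cdim V \<and> V \<subseteq> Y \<and>
    (\<forall>v\<in>V. norm (T v - \<mu> *\<^sub>C v) \<le> \<epsilon> * norm v)"
proof (rule ccontr)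
  assume contr: "\<not> ?thesis"
  have "\<exists>\<Phi> c. finite \<Phi> \<and> (\<forall>f\<in>\<Phi>. bounded_functional f) \<and> c > 0 \<and>
      (\<forall>y\<in>Y \<inter> common_kernel \<Phi>. c * norm y \<le> norm (T y - \<mu> *\<^sub>C y))" for \<mu>
  proof -
    obtain \<epsilon> where "\<epsilon> > 0" "\<nexists>V. closed_csubspace V \<and> infinite_cdim V \<and> V \<subseteq> Y \<and>
        (\<forall>v\<in>V. norm (T v - \<mu> *\<^sub>C v) \<le> \<epsilon> * norm v)"
      using contr by meson
    then show ?thesis
      by (intro bounded_below_on_finite_codim[OF bounded_clinear_on_minus_scaleC[OF T] Y(1)])
  qed
  then obtain \<Phi> :: "complex \<Rightarrow> ('a \<Rightarrow> complex) set" and c :: "complex \<Rightarrow> real" where \<Phi>: "\<And>\<mu>. finite (\<Phi> \<mu>)" "\<And>\<mu>. \<forall>f\<in>\<Phi> \<mu>. bounded_functional f"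
    and c: "\<And>\<mu>. c \<mu> > 0"
    and below: "\<And>\<mu> y. y \<in> Y \<Longrightarrow> y \<in> common_kernel (\<Phi> \<mu>) \<Longrightarrow> c \<mu> * norm y \<le> norm (T y - \<mu> *\<^sub>C y)"
    by (metis IntI)
  obtain K where K: "K \<ge> 0" "\<And>y. y \<in> Y \<Longrightarrow> norm (T y) \<le> K * norm y"
    using bounded_clinear_on_bound[OF T] by blast
  have "cball 0 (K + 1) \<subseteq> (\<Union>\<mu>\<in>cball 0 (K + 1). ball \<mu> (c \<mu> / 2))" using c by force
  then obtain D where D: "finite D" "cball 0 (K + 1) \<subseteq> (\<Union>\<mu>\<in>D. ball \<mu> (c \<mu> / 2))"
    by (rule compactE_image[OF compact_cball open_ball])
  define \<Psi> where "\<Psi> = (\<Union>\<mu>\<in>D. \<Phi> \<mu>)"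
  have \<Psi>: "finite \<Psi>" "\<forall>f\<in>\<Psi>. bounded_functional f" using D(1) \<Phi> by (auto simp: \<Psi>_def)
  define V where "V = Y \<inter> common_kernel \<Psi>"
  have V: "closed_csubspace V"
    unfolding V_def by (intro closed_csubspace_Int Y closed_csubspace_common_kernel \<Psi>)
  then have subV: "complex_vector.subspace V" by (simp add: closed_csubspace_def)
  have infV: "infinite_cdim V"
    unfolding V_def using Y by (intro infinite_cdim_Int_common_kernel \<Psi>) (auto simp: closed_csubspace_def)
  have "V \<subseteq> Y" by (auto simp: V_def)
  define m where "m = Min (insert 1 ((\<lambda>\<mu>. c \<mu> / 2) ` D))"
  have m: "m > 0" "m \<le> 1" "\<And>\<mu>. \<mu> \<in> D \<Longrightarrow> m \<le> c \<mu> / 2"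
  proof -
    show "m \<le> c \<mu> / 2" if "\<mu> \<in> D" for \<mu> unfolding m_def using D(1) that by (intro Min_le) auto
  qed (use D(1) c in \<open>auto simp: m_def\<close>)
  have lower: "m * norm y \<le> norm (T y - \<mu> *\<^sub>C y)" if "y \<in> V" for \<mu> y
  proof (cases "cmod \<mu> \<le> K + 1")
    case True
    then have "\<mu> \<in> (\<Union>\<nu>\<in>D. ball \<nu> (c \<nu> / 2))" by (intro subsetD[OF D(2)]) simp
    then obtain \<nu> where \<nu>: "\<nu> \<in> D" "dist \<nu> \<mu> < c \<nu> / 2" unfolding UN_iff mem_ball by blast
    have "y \<in> Y" "y \<in> common_kernel (\<Phi> \<nu>)"
      using that \<nu> by (auto simp: V_def \<Psi>_def common_kernel_def)
    then have "c \<nu> * norm y \<le> norm (T y - \<nu> *\<^sub>C y)" by (rule below)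
    also have "T y - \<nu> *\<^sub>C y = (T y - \<mu> *\<^sub>C y) - (\<nu> - \<mu>) *\<^sub>C y"
      by (simp add: complex_vector.scale_left_diff_distrib)
    also have "norm \<dots> \<le> norm (T y - \<mu> *\<^sub>C y) + cmod (\<nu> - \<mu>) * norm y"
      by (metis norm_triangle_ineq4 norm_scaleC)
    also have "cmod (\<nu> - \<mu>) * norm y \<le> c \<nu> / 2 * norm y"
      using \<nu>(2) by (intro mult_right_mono) (auto simp: dist_norm)
    finally have "c \<nu> / 2 * norm y \<le> norm (T y - \<mu> *\<^sub>C y)" by simp
    moreover have "m * norm y \<le> c \<nu> / 2 * norm y" using m(3)[OF \<nu>(1)] by (rule mult_right_mono) simp
    ultimately show ?thesis by linarith
  next
    case False
    have "m * norm y \<le> 1 * norm y" using m(2) by (rule mult_right_mono) simp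
    also have "(K + 1) * norm y \<le> cmod \<mu> * norm y" using False by (intro mult_right_mono) auto
    then have "1 * norm y \<le> norm (\<mu> *\<^sub>C y) - K * norm y"
      by (simp add: norm_scaleC algebra_simps)
    also have "\<dots> \<le> norm (\<mu> *\<^sub>C y) - norm (T y)" using K(2)[of y] that \<open>V \<subseteq> Y\<close> by auto
    also have "\<dots> \<le> norm (T y - \<mu> *\<^sub>C y)" by (metis norm_triangle_ineq2 norm_minus_commute)
    finally show ?thesis .
  qed
  have TV: "bounded_clinear_on V T" using T \<open>V \<subseteq> Y\<close> by (rule bounded_clinear_on_subset)
  have "\<exists>\<Lambda> \<delta>. finite \<Lambda> \<and> \<delta> > 0 \<and>
    \<not> (\<exists>v. norm v = 1 \<and> (\<forall>\<mu>\<in>\<Lambda>. \<exists>y\<in>V. norm (T y - \<mu> *\<^sub>C y - v) \<le> \<delta>))"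
  proof (rule no_bounded_approximate_resolvent[OF subV _ _ _ K(1) m(1) lower])
    show "T (x + y) = T x + T y" if "x \<in> V" "y \<in> V" for x y
      using TV that unfolding bounded_clinear_on_def by blast
    show "T (d *\<^sub>C x) = d *\<^sub>C T x" if "x \<in> V" for x d
      using TV that unfolding bounded_clinear_on_def by blast
    show "norm (T x) \<le> K * norm x" if "x \<in> V" for x by (rule K(2)[OF subsetD[OF \<open>V \<subseteq> Y\<close> that]])
  qed
  then obtain \<Lambda> \<delta> where \<Lambda>: "finite \<Lambda>" "\<delta> > 0"
    and no: "\<not> (\<exists>v. norm v = 1 \<and> (\<forall>\<mu>\<in>\<Lambda>. \<exists>y\<in>V. norm (T y - \<mu> *\<^sub>C y - v) \<le> \<delta>))"
    by blast
  define W where "W \<mu> = (\<lambda>y. T y - \<mu> *\<^sub>C y) ` V" for \<mu>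
  have W: "complex_vector.subspace (W \<mu>)" "infinite_cdim (W \<mu>)" for \<mu>
    unfolding W_def
    using subspace_image_clinear_on[OF bounded_clinear_on_minus_scaleC[OF TV] subV order_refl]
      infinite_cdim_image_clinear_on[OF bounded_clinear_on_minus_scaleC[OF TV] subV infV m(1) lower] by auto
  have "\<delta> / 2 > 0" using \<Lambda>(2) by simp
  obtain V' where V': "closed_csubspace V'" "infinite_cdim V'"
    "\<forall>\<mu>\<in>\<Lambda>. \<forall>v\<in>V'. infdist v (W \<mu>) \<le> \<delta> / 2 * norm v"
    using hereditarily_indecomposable_common_nearby[where W = W, OF HI V infV \<Lambda>(1) W \<open>\<delta> / 2 > 0\<close>] by blast
  obtain v where v: "v \<in> V'" "norm v = 1"
    using infinite_cdim_unit_vector[of V'] V' by (auto simp: closed_csubspace_def)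
  have "\<exists>y\<in>V. norm (T y - \<mu> *\<^sub>C y - v) \<le> \<delta>" if "\<mu> \<in> \<Lambda>" for \<mu>
  proof -
    have "infdist v (W \<mu>) \<le> \<delta> / 2 * norm v" using V'(3) that v(1) by blast
    then have "infdist v (W \<mu>) < \<delta>" using v(2) \<Lambda>(2) by simp
    moreover have "W \<mu> \<noteq> {}" using complex_vector.subspace_0[OF W(1)] by blast
    ultimately obtain w where w: "w \<in> W \<mu>" "norm (v - w) < \<delta>" by (rule infdist_less_obtain)
    then obtain y where "y \<in> V" "w = T y - \<mu> *\<^sub>C y" by (auto simp: W_def)
    then show ?thesis using w(2) by (intro bexI[of _ y]) (simp_all add: norm_minus_commute)
  qed
  then show False using no v(2) by blast
qed

text \<open>The scalar is the approximate eigenvalue \<open>\<mu>\<close>. A vector \<open>w\<close> in the span of the given basic sequence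
  that is close to a unit vector of an infinite-dimensional subspace on which \<open>T - \<mu>\<close> is small
  inherits the smallness, as \<open>T - \<mu>\<close> is bounded.\<close>

lemma hereditarily_indecomposable_operator_decomposition:
  fixes Y :: "'a::complex_banach set" and T :: "'a \<Rightarrow> 'a"
  assumes HI: "hereditarily_indecomposable \<F> TYPE('a)"
    and Y: "closed_csubspace Y" "infinite_cdim Y" and T: "bounded_clinear_on Y T"
  shows "\<exists>(c :: complex) S. strictly_singular \<F> Y S \<and> (\<forall>y\<in>Y. T y = c *\<^sub>C y + S y)"
proof -
  obtain \<mu> where \<mu>: "\<And>\<epsilon>. \<epsilon> > 0 \<Longrightarrow> \<exists>V. closed_csubspace V \<and> infinite_cdim V \<and> V \<subseteq> Y \<and>
    (\<forall>v\<in>V. norm (T v - \<mu> *\<^sub>C v) \<le> \<epsilon> * norm v)"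
    using hereditarily_indecomposable_approximate_eigenvalue[OF HI Y T] by metis
  define S where "S y = T y - \<mu> *\<^sub>C y" for y
  have S: "bounded_clinear_on Y S" unfolding S_def by (rule bounded_clinear_on_minus_scaleC[OF T])
  have sub: "complex_vector.subspace Y" using Y by (simp add: closed_csubspace_def)
  obtain K where K: "K \<ge> 0" "\<And>y. y \<in> Y \<Longrightarrow> norm (S y) \<le> K * norm y"
    using bounded_clinear_on_bound[OF S] by blast
  have "\<exists>F\<in>\<F>. \<exists>z\<in>closed_cspan (x ` F) - {0}. norm (S z) \<le> \<epsilon> * norm z"
    if "\<epsilon> > 0" and x: "basic_sequence x" "\<forall>n\<ge>1. x n \<in> Y" for \<epsilon> and x :: "nat \<Rightarrow> 'a"
  proof -
    \<comment> \<open>Being basic says nothing about the vector at the index \<open>0\<close>, which may lie outside \<open>Y\<close>.\<close>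
    define x' where "x' = x(0 := 0)"
    have "x' ` {1..} = x ` {1..}" unfolding x'_def by (intro image_cong) auto
    moreover have "x' (Suc n) = x (Suc n)" for n by (simp add: x'_def)
    ultimately have basic: "basic_sequence x'" using x(1) by (simp add: basic_sequence_def)
    have x'Y: "x' n \<in> Y" for n
      using x(2) complex_vector.subspace_0[OF sub] by (cases n) (auto simp: x'_def)
    \<comment> \<open>The closeness is chosen such that \<open>\<parallel>S w\<parallel> \<le> \<epsilon> / 4 + K \<eta> \<le> \<epsilon> / 2 \<le> \<epsilon> \<parallel>w\<parallel>\<close>.\<close>
    define \<eta> where "\<eta> = min (1 / 2) (\<epsilon> / (4 * (K + 1)))"
    have \<eta>: "\<eta> > 0" "\<eta> \<le> 1 / 2" "K * \<eta> \<le> \<epsilon> / 4"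
    proof -
      have "\<eta> \<le> \<epsilon> / (4 * (K + 1))" by (simp add: \<eta>_def)
      then have "(K + 1) * \<eta> \<le> \<epsilon> / 4" using K(1) by (simp add: field_simps)
      moreover show "\<eta> > 0" using K(1) \<open>\<epsilon> > 0\<close> by (simp add: \<eta>_def)
      ultimately show "K * \<eta> \<le> \<epsilon> / 4" by (simp add: distrib_right)
      show "\<eta> \<le> 1 / 2" unfolding \<eta>_def by (rule min.cobounded1)
    qed
    have "\<epsilon> / 4 > 0" using \<open>\<epsilon> > 0\<close> by simp
    then obtain V where V: "closed_csubspace V" "infinite_cdim V" "V \<subseteq> Y"
      "\<And>v. v \<in> V \<Longrightarrow> norm (S v) \<le> \<epsilon> / 4 * norm v"
      using \<mu> unfolding S_def by blast
    then obtain F z where F: "F \<in> \<F>" and z: "z \<in> V" "norm z = 1" "infdist z (closed_cspan (x' ` F)) < \<eta>"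
      using HI basic \<eta>(1) unfolding hereditarily_indecomposable_def by blast
    have "closed_cspan (x' ` F) \<noteq> {}"
      unfolding closed_cspan_def using complex_vector.span_zero by auto
    then obtain w where w: "w \<in> closed_cspan (x' ` F)" "norm (z - w) < \<eta>"
      using infdist_less_obtain[OF z(3)] by blast
    have wY: "w \<in> Y" using closed_cspan_minimal[OF _ Y(1), of "x' ` F"] x'Y w(1) by blast
    have zY: "z \<in> Y" using z V by blast
    have "1 - \<eta> \<le> norm w" using norm_triangle_ineq2[of z w] w(2) z(2) by linarith
    then have nw: "1 / 2 \<le> norm w" using \<eta>(2) by linarith
    have "complex_vector.span (x' ` F) \<subseteq> complex_vector.span (x ` F)"
      by (rule complex_vector.span_minimal)
        (auto simp: x'_def complex_vector.span_zero intro: complex_vector.span_base)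
    then have "w \<in> closed_cspan (x ` F)" using w(1) closure_mono unfolding closed_cspan_def by blast
    moreover have "w \<noteq> 0" using nw by auto
    moreover have "norm (S w) \<le> \<epsilon> * norm w"
    proof -
      have "S w = S z - S (z - w)" using bounded_clinear_on_diff[OF S sub zY wY] by simp
      then have "norm (S w) \<le> norm (S z) + norm (S (z - w))" by (simp only: norm_triangle_ineq4)
      also have "norm (S z) \<le> \<epsilon> / 4" using V(4)[OF z(1)] z(2) by simp
      also have "norm (S (z - w)) \<le> K * norm (z - w)"
        by (intro K(2) complex_vector.subspace_diff[OF sub] zY wY)
      also have "\<dots> \<le> K * \<eta>" using w(2) K(1) by (intro mult_left_mono) auto
      also have "\<dots> \<le> \<epsilon> / 4" by (rule \<eta>(3))
      finally have "norm (S w) \<le> \<epsilon> * (1 / 2)" by simp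
      also have "\<dots> \<le> \<epsilon> * norm w" using nw \<open>\<epsilon> > 0\<close> by (intro mult_left_mono) auto
      finally show ?thesis .
    qed
    ultimately show ?thesis using F by blast
  qed
  then have "strictly_singular \<F> Y S"
    unfolding strictly_singular_def by (intro conjI S allI impI) (elim conjE)
  moreover have "\<forall>y\<in>Y. T y = \<mu> *\<^sub>C y + S y" by (simp add: S_def)
  ultimately show ?thesis by blast
qed

theorem corollary6p15:
  fixes fs :: "countable_ordinal \<Rightarrow> nat \<Rightarrow> countable_ordinal"
    and \<xi> :: countable_ordinal
    and Y :: "'a::complex_banach set"
    and T :: "'a \<Rightarrow> 'a"
  assumes "fundamental_sequences fs"
    and "1 \<le> \<xi>"
    and "hereditarily_indecomposable (schreier fs \<xi>) TYPE('a)"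
    and "closed_csubspace Y"
    and "infinite_cdim Y"
    and "bounded_clinear_on Y T"
  shows "\<exists>(c :: complex) S. strictly_singular (schreier fs \<xi>) Y S \<and> (\<forall>y\<in>Y. T y = c *\<^sub>C y + S y)"
  using assms(3-6) by (rule hereditarily_indecomposable_operator_decomposition)

end
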